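(* Assume each $f_i$ is differentiable with $\|\nabla f_i(x)-\nabla f_i(y)\|\le L\|x-y\|$ for all $x,y\in\mathbb{R}^d$, and that $f$ satisfies the Polyak-Lojasiewicz condition with constant $\mu>0$: $\|\nabla f(x)\|^2\ge 2\mu(f(x)-f(x^* ))$ for all $x$, where $x^*$ is a global minimizer of $f$. Let $\epsilon>0$ and run the SCSG algorithm with $$b_j\equiv 1,\qquad B_j\equiv B=\min\left\{\frac{12\mathcal{H}^*}{\mu\epsilon},\,n\right\},\qquad \eta_j\equiv\eta=\frac{1}{6LB^{2/3}},$$ where $B$ (rounded up to an integer) satisfies $B\ge 8$. Then $$\mathbb{E}\,C_{\mathrm{comp}}(\epsilon)=O\left(\left\{\left(\frac{\mathcal{H}^*}{\mu\epsilon}\wedge n\right)+\frac1\mu\left(\frac{\mathcal{H}^*}{\mu\epsilon}\wedge n\right)^{2/3}\right\}\log\frac{\Delta_f}{\epsilon}\right),$$ where the hidden constant depends only on $L$.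
   Context: Let $f(x)=\frac1n\sum_{i=1}^n f_i(x)$ on $\mathbb{R}^d$, $\|\cdot\|$ the Euclidean norm, $a\wedge b=\min\{a,b\}$, $0<L<\infty$, $f^*=\inf_x f(x)=f(x^* )$, $\Delta_f=f(\tilde{x}_0)-f^*$, and $\mathcal{H}^*=\sup_x \frac1n\sum_{i=1}^n\|\nabla f_i(x)-\nabla f(x)\|^2<\infty$. For $\mathcal{I}\subset\{1,\dots,n\}$ write $\nabla f_{\mathcal{I}}(x)=\frac{1}{|\mathcal{I}|}\sum_{i\in\mathcal{I}}\nabla f_i(x)$. $N\sim\mathrm{Geom}(\rho)$ means $P(N=k)=\rho^k(1-\rho)$, $k=0,1,2,\dots$. SCSG algorithm. Inputs: number of epochs $T$, deterministic initial iterate $\tilde{x}_0\in\mathbb{R}^d$, stepsizes $\eta_j>0$, batch sizes $B_j\in\{1,\dots,n\}$, mini-batch sizes $b_j\in\{1,\dots,n\}$. For $j=1,\dots,T$: sample $\mathcal{I}_j\subset\{1,\dots,n\}$ uniformly among subsets of size $B_j$; set $g_j=\nabla f_{\mathcal{I}_j}(\tilde{x}_{j-1})$ and $x^{(j)}_0=\tilde{x}_{j-1}$; draw $N_j\sim\mathrm{Geom}(B_j/(B_j+b_j))$; for $k=1,\dots,N_j$ sample $\tilde{\mathcal{I}}_{k-1}\subset\{1,\dots,n\}$ uniformly among subsets of size $b_j$, set $\nu^{(j)}_{k-1}=\nabla f_{\tilde{\mathcal{I}}_{k-1}}(x^{(j)}_{k-1})-\nabla f_{\tilde{\mathcal{I}}_{k-1}}(x^{(j)}_0)+g_j$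 and $x^{(j)}_k=x^{(j)}_{k-1}-\eta_j\nu^{(j)}_{k-1}$; finally set $\tilde{x}_j=x^{(j)}_{N_j}$. All random draws are independent. The output (P-L case) is $\tilde{x}_T$. Complexity. Computing $\nabla f_{\mathcal{I}}(x)$ costs $|\mathcal{I}|$ units, and epoch $j$ is charged $B_j+b_jN_j$ units (expected cost $2B_j$). In the P-L case accuracy is measured by function values: $T(\epsilon)=\min\{T:\ \mathbb{E}(f(\tilde{x}_{T'})-f^* )\le\epsilon\text{ for all }T'\ge T\}$. $C_{\mathrm{comp}}(\epsilon)$ is the cost of reaching an $\epsilon$-accurate solution, i.e. the total cost of the first $T(\epsilon)$ epochs, so $\mathbb{E}\,C_{\mathrm{comp}}(\epsilon)\le 2\sum_{j=1}^{T(\epsilon)}B_j$. Convention: $\log(\Delta_f/\epsilon)$ is read as $\max\{\log(\Delta_f/\epsilon),1\}$. *)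

theory Defs
  imports
    "HOL-Probability.Probability"
    "HOL-Library.Poly_Mapping"
    "HOL-Library.Monad_Syntax"
begin

section \<open>Euclidean spaces of arbitrary dimension inside one type\<close>

text \<open>
  The hidden constant of the complexity bound must not depend on the dimension \<open>d\<close>, so \<open>d\<close> has to
  be a natural number that is quantified inside the formula. We therefore equip the finitely
  supported sequences \<^typ>\<open>nat \<Rightarrow>\<^sub>0 real\<close> with the usual dot product and use the subspace of the
  sequences that vanish from index \<open>d\<close> on as \<open>\<real>\<^sup>d\<close>.
\<close>

instantiation poly_mapping :: (type, real_inner) real_inner
begin

definition scaleR_poly_mapping :: "real \<Rightarrow> ('a \<Rightarrow>\<^sub>0 'b) \<Rightarrow> ('a \<Rightarrow>\<^sub>0 'b)" where
  "scaleR_poly_mapping r x = Poly_Mapping.map (scaleR r) x"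

definition inner_poly_mapping :: "('a \<Rightarrow>\<^sub>0 'b) \<Rightarrow> ('a \<Rightarrow>\<^sub>0 'b) \<Rightarrow> real" where
  "inner_poly_mapping x y =
     (\<Sum>i\<in>Poly_Mapping.keys x. Poly_Mapping.lookup x i \<bullet> Poly_Mapping.lookup y i)"

definition norm_poly_mapping :: "('a \<Rightarrow>\<^sub>0 'b) \<Rightarrow> real" where
  "norm_poly_mapping x = sqrt (inner x x)"

definition sgn_poly_mapping :: "('a \<Rightarrow>\<^sub>0 'b) \<Rightarrow> ('a \<Rightarrow>\<^sub>0 'b)" where
  "sgn_poly_mapping x = scaleR (inverse (norm x)) x"

definition dist_poly_mapping :: "('a \<Rightarrow>\<^sub>0 'b) \<Rightarrow> ('a \<Rightarrow>\<^sub>0 'b) \<Rightarrow> real" where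
  "dist_poly_mapping x y = norm (x - y)"

definition uniformity_poly_mapping :: "(('a \<Rightarrow>\<^sub>0 'b) \<times> ('a \<Rightarrow>\<^sub>0 'b)) filter" where
  "uniformity_poly_mapping = (INF e\<in>{0<..}. principal {(x, y). dist x y < e})"

definition open_poly_mapping :: "('a \<Rightarrow>\<^sub>0 'b) set \<Rightarrow> bool" where
  "open_poly_mapping U = (\<forall>x\<in>U. eventually (\<lambda>(x', y). x' = x \<longrightarrow> y \<in> U) uniformity)"

lemma lookup_scaleR [simp]:
  "Poly_Mapping.lookup (r *\<^sub>R x) i = r *\<^sub>R Poly_Mapping.lookup (x :: 'a \<Rightarrow>\<^sub>0 'b) i"
  by (simp add: scaleR_poly_mapping_def Poly_Mapping.map.rep_eq when_def)

lemma inner_poly_mapping_superset: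
  fixes x y :: "'a \<Rightarrow>\<^sub>0 'b"
  assumes "finite A" "Poly_Mapping.keys x \<subseteq> A"
  shows "x \<bullet> y = (\<Sum>i\<in>A. Poly_Mapping.lookup x i \<bullet> Poly_Mapping.lookup y i)"
  unfolding inner_poly_mapping_def
  using assms by (intro sum.mono_neutral_left) (auto simp: in_keys_iff)

instance
proof
  fix x y z :: "'a \<Rightarrow>\<^sub>0 'b" and r s :: real
  show "r *\<^sub>R (x + y) = r *\<^sub>R x + r *\<^sub>R y"
    by (rule poly_mapping_eqI) (simp add: lookup_add scaleR_right_distrib)
  show "(r + s) *\<^sub>R x = r *\<^sub>R x + s *\<^sub>R x"
    by (rule poly_mapping_eqI) (simp add: lookup_add scaleR_left_distrib)
  show "r *\<^sub>R s *\<^sub>R x = (r * s) *\<^sub>R x"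
    by (rule poly_mapping_eqI) simp
  show "1 *\<^sub>R x = x"
    by (rule poly_mapping_eqI) simp
  show "sgn x = inverse (norm x) *\<^sub>R x"
    by (fact sgn_poly_mapping_def)
  show "dist x y = norm (x - y)"
    by (fact dist_poly_mapping_def)
  show "uniformity = (INF e\<in>{0<..}. principal {(x :: 'a \<Rightarrow>\<^sub>0 'b, y). dist x y < e})"
    by (fact uniformity_poly_mapping_def)
  show "open U = (\<forall>x\<in>U. \<forall>\<^sub>F (x', y) in uniformity. x' = x \<longrightarrow> y \<in> U)" for U :: "('a \<Rightarrow>\<^sub>0 'b) set"
    by (fact open_poly_mapping_def)
  show "norm x = sqrt (x \<bullet> x)"
    by (fact norm_poly_mapping_def)
  define A where "A = Poly_Mapping.keys x \<union> Poly_Mapping.keys y \<union> Poly_Mapping.keys (x + y)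
    \<union> Poly_Mapping.keys (r *\<^sub>R x)"
  have ip: "u \<bullet> v = (\<Sum>i\<in>A. Poly_Mapping.lookup u i \<bullet> Poly_Mapping.lookup v i)"
    if "Poly_Mapping.keys u \<subseteq> A" for u v :: "'a \<Rightarrow>\<^sub>0 'b"
    using that by (intro inner_poly_mapping_superset) (auto simp: A_def)
  show "x \<bullet> y = y \<bullet> x"
    by (subst (1 2) ip) (auto simp: A_def inner_commute)
  show "(x + y) \<bullet> z = x \<bullet> z + y \<bullet> z"
    by (subst (1 2 3) ip) (auto simp: A_def lookup_add inner_add_left sum.distrib)
  show "(r *\<^sub>R x) \<bullet> y = r * (x \<bullet> y)"
    by (subst (1 2) ip) (auto simp: A_def sum_distrib_left)
  show "0 \<le> x \<bullet> x"
    by (simp add: inner_poly_mapping_def sum_nonneg)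
  show "x \<bullet> x = 0 \<longleftrightarrow> x = 0"
    by (auto simp: inner_poly_mapping_def sum_nonneg_eq_0_iff in_keys_iff intro!: poly_mapping_eqI)
qed

end

definition Rn :: "nat \<Rightarrow> (nat \<Rightarrow>\<^sub>0 real) set" where
  "Rn d = {x. \<forall>i\<ge>d. Poly_Mapping.lookup x i = 0}"

lemma subspace_Rn: "subspace (Rn d)"
  by (auto simp: subspace_def Rn_def lookup_add)

lemma inner_Rn:
  assumes "x \<in> Rn d"
  shows "x \<bullet> y = (\<Sum>i<d. Poly_Mapping.lookup x i * Poly_Mapping.lookup y i)"
proof -
  have "Poly_Mapping.keys x \<subseteq> {..<d}"
    using assms by (force simp: Rn_def in_keys_iff not_le [symmetric])
  then show ?thesis
    by (simp add: inner_poly_mapping_superset [of "{..<d}"])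
qed


section \<open>Gradients and finite sums\<close>

text \<open>
  The gradient of \<open>f\<close> at \<open>x\<close> within the Euclidean space \<open>V\<close>. A Frechet derivative within \<open>V\<close> only
  sees increments in \<open>V\<close>, so its representing vector is unique only once it is taken from \<open>V\<close>.
\<close>

definition grad :: "'a::real_inner set \<Rightarrow> ('a \<Rightarrow> real) \<Rightarrow> 'a \<Rightarrow> 'a" where
  "grad V f x = (THE g. g \<in> V \<and> (f has_derivative (\<lambda>h. g \<bullet> h)) (at x within V))"

lemma grad_eqI:
  fixes V :: "'a::real_inner set"
  assumes V: "subspace V" and x: "x \<in> V" and g: "g \<in> V"
    and D: "(f has_derivative (\<lambda>h. g \<bullet> h)) (at x within V)"
  shows "grad V f x = g"
  unfolding grad_def
proof (rule the_equality)
  show "g \<in> V \<and> (f has_derivative (\<lambda>h. g \<bullet> h)) (at x within V)"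
    using g D by blast
next
  fix g' assume g': "g' \<in> V \<and> (f has_derivative (\<lambda>h. g' \<bullet> h)) (at x within V)"
  define u where "u = g - g'"
  have u: "u \<in> V"
    using V g g' by (simp add: u_def subspace_diff)
  have "((\<lambda>y. f y - f y) has_derivative (\<lambda>h. g \<bullet> h - g' \<bullet> h)) (at x within V)"
    using D g' by (blast intro: has_derivative_diff)
  then have *: "((\<lambda>y. 0) has_derivative (\<lambda>h. u \<bullet> h)) (at x within V)"
    by (simp add: u_def inner_diff_left)
  have line: "(\<lambda>t. x + t *\<^sub>R u) ` UNIV \<subseteq> V"
    using V x u by (auto simp: subspace_add subspace_scale)
  have aff: "((\<lambda>t. x + t *\<^sub>R u) has_derivative (\<lambda>t. t *\<^sub>R u)) (at 0 within UNIV)"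
    by (auto intro!: derivative_eq_intros)
  have "((\<lambda>y. 0 :: real) has_derivative (\<lambda>h. u \<bullet> h)) (at (x + 0 *\<^sub>R u) within range (\<lambda>t. x + t *\<^sub>R u))"
    using has_derivative_subset [OF * line] by simp
  from has_derivative_in_compose [OF aff this]
  have "((\<lambda>t::real. 0 :: real) has_derivative (\<lambda>t. u \<bullet> (t *\<^sub>R u))) (at 0)"
    by simp
  then have "(\<lambda>t::real. u \<bullet> (t *\<^sub>R u)) = (\<lambda>_. 0)"
    by (rule has_derivative_unique) (rule has_derivative_const)
  then have "u \<bullet> (1 *\<^sub>R u) = 0"
    by (rule fun_cong)
  then show "g' = g"
    by (simp add: u_def)
qed

lemma has_derivative_grad:
  assumes x: "x \<in> Rn d" and "f differentiable (at x within Rn d)"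
  shows "grad (Rn d) f x \<in> Rn d"
    and "(f has_derivative (\<lambda>h. grad (Rn d) f x \<bullet> h)) (at x within Rn d)"
proof -
  obtain D where D: "(f has_derivative D) (at x within Rn d)"
    using assms(2) by (auto simp: differentiable_def)
  then interpret D: bounded_linear D
    by (rule has_derivative_bounded_linear)
  define e :: "nat \<Rightarrow> nat \<Rightarrow>\<^sub>0 real" where "e i = Poly_Mapping.single i 1" for i
  define g where "g = (\<Sum>i<d. D (e i) *\<^sub>R e i)"
  have lk: "Poly_Mapping.lookup (\<Sum>i<d. c i *\<^sub>R e i) j = (if j < d then c j else 0)" for c j
  proof -
    have "Poly_Mapping.lookup (\<Sum>i<d. c i *\<^sub>R e i) j
      = (\<Sum>i<d. Poly_Mapping.lookup (c i *\<^sub>R e i) j)"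
      by (rule lookup_sum)
    also have "\<dots> = (\<Sum>i<d. if i = j then c j else 0)"
      by (rule sum.cong) (auto simp: e_def lookup_single when_def)
    finally show ?thesis
      by simp
  qed
  have g: "g \<in> Rn d"
    by (simp add: g_def Rn_def lk)
  have Dg: "D h = g \<bullet> h" if "h \<in> Rn d" for h
  proof -
    have "h = (\<Sum>i<d. Poly_Mapping.lookup h i *\<^sub>R e i)"
      using that by (intro poly_mapping_eqI) (simp add: lk Rn_def)
    then have "D h = D (\<Sum>i<d. Poly_Mapping.lookup h i *\<^sub>R e i)"
      by simp
    also have "\<dots> = (\<Sum>i<d. Poly_Mapping.lookup h i * D (e i))"
      by (simp add: D.sum D.scaleR)
    also have "\<dots> = g \<bullet> h"
      by (simp add: inner_Rn [OF g]) (simp add: g_def lk mult.commute)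
    finally show ?thesis .
  qed
  have D': "(f has_derivative (\<lambda>h. g \<bullet> h)) (at x within Rn d)"
    unfolding has_derivative_within'
  proof (intro conjI allI impI)
    show "bounded_linear (\<lambda>h. g \<bullet> h)"
      by (rule bounded_linear_inner_right)
  next
    fix \<epsilon> :: real assume "0 < \<epsilon>"
    then obtain \<delta> where "0 < \<delta>" and \<delta>: "\<And>y. y \<in> Rn d \<Longrightarrow> 0 < norm (y - x) \<Longrightarrow> norm (y - x) < \<delta> \<Longrightarrow>
        norm (f y - f x - D (y - x)) / norm (y - x) < \<epsilon>"
      using D unfolding has_derivative_within' by blast
    have "norm (f y - f x - g \<bullet> (y - x)) / norm (y - x) < \<epsilon>"
      if "y \<in> Rn d" "0 < norm (y - x)" "norm (y - x) < \<delta>" for y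
      using \<delta> [OF that] Dg [of "y - x"] subspace_diff [OF subspace_Rn that(1) x] by simp
    with \<open>0 < \<delta>\<close> show "\<exists>\<delta>>0. \<forall>y\<in>Rn d. 0 < norm (y - x) \<and> norm (y - x) < \<delta> \<longrightarrow>
        norm (f y - f x - g \<bullet> (y - x)) / norm (y - x) < \<epsilon>"
      by blast
  qed
  have "grad (Rn d) f x = g"
    by (rule grad_eqI [OF subspace_Rn x g D'])
  with g D' show "grad (Rn d) f x \<in> Rn d"
    and "(f has_derivative (\<lambda>h. grad (Rn d) f x \<bullet> h)) (at x within Rn d)"
    by simp_all
qed

definition avg_fun :: "nat \<Rightarrow> (nat \<Rightarrow> 'a \<Rightarrow> real) \<Rightarrow> 'a \<Rightarrow> real" where
  "avg_fun n f x = 1 / real n * (\<Sum>i=1..n. f i x)"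

definition batch_grad ::
  "'a::real_inner set \<Rightarrow> (nat \<Rightarrow> 'a \<Rightarrow> real) \<Rightarrow> nat set \<Rightarrow> 'a \<Rightarrow> 'a" where
  "batch_grad V f I x = (1 / real (card I)) *\<^sub>R (\<Sum>i\<in>I. grad V (f i) x)"

definition grad_variance ::
  "'a::real_inner set \<Rightarrow> nat \<Rightarrow> (nat \<Rightarrow> 'a \<Rightarrow> real) \<Rightarrow> 'a \<Rightarrow> real" where
  "grad_variance V n f x =
     1 / real n * (\<Sum>i=1..n. (norm (grad V (f i) x - grad V (avg_fun n f) x))\<^sup>2)"


section \<open>The SCSG algorithm\<close>

text \<open>
  All randomness is discrete, so a run is a probability mass function; independence of the draws is
  expressed by the monadic bind.
\<close>

definition minibatch :: "nat \<Rightarrow> nat \<Rightarrow> nat set pmf" where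
  "minibatch n b = pmf_of_set {I. I \<subseteq> {1..n} \<and> card I = b}"

text \<open>The law of \<open>x\<^sub>k\<close> in the inner loop of an epoch with snapshot \<open>x0\<close> and snapshot gradient \<open>g\<close>.\<close>

primrec scsg_inner ::
  "'a::real_inner set \<Rightarrow> nat \<Rightarrow> (nat \<Rightarrow> 'a \<Rightarrow> real) \<Rightarrow> nat \<Rightarrow> real \<Rightarrow> 'a \<Rightarrow> 'a \<Rightarrow> nat \<Rightarrow> 'a pmf" where
  "scsg_inner V n f b \<eta> x0 g 0 = return_pmf x0"
| "scsg_inner V n f b \<eta> x0 g (Suc k) = do {
     x \<leftarrow> scsg_inner V n f b \<eta> x0 g k;
     I \<leftarrow> minibatch n b;
     return_pmf (x - \<eta> *\<^sub>R (batch_grad V f I x - batch_grad V f I x0 + g))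
   }"

text \<open>
  One epoch, returning the new iterate and the cost charged to the epoch. The library's
  \<^term>\<open>geometric_pmf p\<close> has mass \<open>(1 - p)\<^sup>k p\<close> at \<open>k\<close>, so its parameter is \<open>1 - \<rho>\<close>.
\<close>

definition scsg_epoch ::
  "'a::real_inner set \<Rightarrow> nat \<Rightarrow> (nat \<Rightarrow> 'a \<Rightarrow> real) \<Rightarrow> nat \<Rightarrow> nat \<Rightarrow> real \<Rightarrow> 'a \<Rightarrow> ('a \<times> nat) pmf" where
  "scsg_epoch V n f B b \<eta> x = do {
     I \<leftarrow> minibatch n B;
     N \<leftarrow> geometric_pmf (1 - real B / real (B + b));
     y \<leftarrow> scsg_inner V n f b \<eta> x (batch_grad V f I x) N;
     return_pmf (y, B + b * N)
   }"

text \<open>The joint law of the iterate after \<open>T\<close> epochs and the total cost of these epochs.\<close>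

primrec scsg ::
  "'a::real_inner set \<Rightarrow> nat \<Rightarrow> (nat \<Rightarrow> 'a \<Rightarrow> real) \<Rightarrow> (nat \<Rightarrow> nat) \<Rightarrow> (nat \<Rightarrow> nat) \<Rightarrow> (nat \<Rightarrow> real)
     \<Rightarrow> 'a \<Rightarrow> nat \<Rightarrow> ('a \<times> nat) pmf" where
  "scsg V n f B b \<eta> x0 0 = return_pmf (x0, 0)"
| "scsg V n f B b \<eta> x0 (Suc T) = do {
     (x, c) \<leftarrow> scsg V n f B b \<eta> x0 T;
     (y, c') \<leftarrow> scsg_epoch V n f (B (Suc T)) (b (Suc T)) (\<eta> (Suc T)) x;
     return_pmf (y, c + c')
   }"

text \<open>
  Expectations of nonnegative quantities are taken in \<^typ>\<open>ennreal\<close>, so that a non-integrable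
  quantity has expectation \<open>\<infinity>\<close>. The function \<open>err\<close> measures the accuracy of the last iterate.
\<close>

definition eps_accurate_from ::
  "(nat \<Rightarrow> ('a \<times> nat) pmf) \<Rightarrow> ('a \<Rightarrow> real) \<Rightarrow> real \<Rightarrow> nat \<Rightarrow> bool" where
  "eps_accurate_from run err \<epsilon> T \<longleftrightarrow>
     (\<forall>T'\<ge>T. (\<integral>\<^sup>+ (x, c). ennreal (err x) \<partial>measure_pmf (run T')) \<le> ennreal \<epsilon>)"

text \<open>Meaningful only if some \<open>T\<close> qualifies; the statement asserts this separately.\<close>

definition T_eps :: "(nat \<Rightarrow> ('a \<times> nat) pmf) \<Rightarrow> ('a \<Rightarrow> real) \<Rightarrow> real \<Rightarrow> nat" where
  "T_eps run err \<epsilon> = (LEAST T. eps_accurate_from run err \<epsilon> T)"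

definition expected_C_comp :: "(nat \<Rightarrow> ('a \<times> nat) pmf) \<Rightarrow> ('a \<Rightarrow> real) \<Rightarrow> real \<Rightarrow> ennreal" where
  "expected_C_comp run err \<epsilon> =
     (\<integral>\<^sup>+ (x, c). ennreal (real c) \<partial>measure_pmf (run (T_eps run err \<epsilon>)))"

end

theory Submission
  imports Defs
begin

text \<open>
  Consider one epoch with snapshot \<open>x0\<close> and snapshot gradient \<open>g\<close>, and let \<open>e = g - GF x0\<close>, where \<open>GF\<close>
  is the gradient of the average \<open>F\<close>. Write \<open>B = t\<^sup>3\<close>, so that \<open>\<eta> = 1 / (6 L t\<^sup>2)\<close>. The function
  \<open>F x - F xs + c (norm (x - x0))\<^sup>2\<close> with \<open>c = L / (4 t)\<close> is a Lyapunov function of the inner loop: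
  in expectation, a step multiplies the distance term by at most \<open>1 + 1 / B\<close>, lowers the error term by
  \<open>\<eta> / 2 (norm (GF x))\<^sup>2 \<ge> \<eta> \<mu> (F x - F xs)\<close>, and adds \<open>\<eta> / 2 (norm e)\<^sup>2\<close> (\<open>lyapunov_step\<close>,
  \<open>inner_recurrence\<close>).

  The length \<open>N\<close> of the inner loop is geometric with mean \<open>B\<close>. Summing the recurrence against this law
  cancels the distance term altogether (\<open>geometric_weighted_recurrence\<close>), and the epoch becomes a
  contraction: with \<open>s = B \<eta> \<mu>\<close>, the expected new error is at most
  \<open>(F x0 - F xs + B \<eta> / 2 E (norm e)\<^sup>2) / (1 + s)\<close> (\<open>epoch_contraction\<close>).

  The batch size controls the noise. If \<open>B = n\<close> then \<open>e = 0\<close>; otherwise \<open>E (norm e)\<^sup>2 \<le> H / B \<le> \<mu> \<epsilon> / 12\<close>,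
  where \<open>H\<close> bounds the variance of a single random component gradient, because sampling without
  replacement has at most the variance of independent sampling
  (\<open>batch_grad_variance\<close>, \<open>snapshot_error_le\<close>). So after \<open>T\<close> epochs the expected error is at most
  \<open>\<epsilon> / 24 + \<Delta> / (1 + s)\<^sup>T\<close>, where \<open>\<Delta>\<close> is the initial error (\<open>scsg_error\<close>). It stays below \<open>\<epsilon>\<close> once
  \<open>T\<close> is at least \<open>2 (1 + 1 / s) max (ln (\<Delta> / \<epsilon>)) 1\<close>. An epoch costs \<open>2 B\<close> on average, and
  \<open>B (1 + 1 / s) = B + 6 L B\<^bsup>2/3\<^esup> / \<mu>\<close> is, up to a constant depending on \<open>L\<close>, the claimed bound.
\<close>

section \<open>Mean squares and sampling without replacement\<close>

lemma mean_square_decomposition: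
  fixes v :: "nat \<Rightarrow> 'a::real_inner"
  assumes n: "1 \<le> n" and p: "p = (1 / real n) *\<^sub>R (\<Sum>i=1..n. v i)"
  shows "1 / real n * (\<Sum>i=1..n. (norm (v i))\<^sup>2)
           = (norm p)\<^sup>2 + 1 / real n * (\<Sum>i=1..n. (norm (v i - p))\<^sup>2)"
proof -
  have sv: "(\<Sum>i=1..n. v i) = real n *\<^sub>R p"
    using n by (simp add: p)
  have "(\<Sum>i=1..n. (norm (v i - p))\<^sup>2)
      = (\<Sum>i=1..n. (norm (v i))\<^sup>2 - 2 * (v i \<bullet> p) + (norm p)\<^sup>2)"
    by (intro sum.cong refl)
      (simp add: power2_norm_eq_inner inner_diff_left inner_diff_right inner_commute)
  also have "\<dots> = (\<Sum>i=1..n. (norm (v i))\<^sup>2) - 2 * ((\<Sum>i=1..n. v i) \<bullet> p) + real n * (norm p)\<^sup>2"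
    by (simp add: sum.distrib sum_subtractf sum_distrib_left inner_sum_left)
  also have "\<dots> = (\<Sum>i=1..n. (norm (v i))\<^sup>2) - real n * (norm p)\<^sup>2"
    unfolding sv by (simp add: power2_norm_eq_inner)
  finally show ?thesis
    using n by (simp add: field_simps)
qed

lemma card_subsets_containing:
  assumes "finite A" "J \<subseteq> A" "card J \<le> b"
  shows "card {I. I \<subseteq> A \<and> card I = b \<and> J \<subseteq> I} = (card A - card J) choose (b - card J)"
proof -
  have fJ: "finite J"
    using assms finite_subset by blast
  have "bij_betw (\<lambda>K. K \<union> J) {K. K \<subseteq> A - J \<and> card K = b - card J}
          {I. I \<subseteq> A \<and> card I = b \<and> J \<subseteq> I}"
  proof (rule bij_betw_byWitness [where f' = "\<lambda>I. I - J"])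
    show "(\<lambda>K. K \<union> J) ` {K. K \<subseteq> A - J \<and> card K = b - card J}
        \<subseteq> {I. I \<subseteq> A \<and> card I = b \<and> J \<subseteq> I}"
    proof safe
      fix K assume K: "K \<subseteq> A - J" "card K = b - card J"
      then have "finite K"
        using assms(1) by (meson Diff_subset finite_subset)
      then have "card (K \<union> J) = card K + card J"
        using K fJ by (intro card_Un_disjoint) auto
      then show "card (K \<union> J) = b"
        using K assms(3) by simp
    qed (use assms in auto)
    show "(\<lambda>I. I - J) ` {I. I \<subseteq> A \<and> card I = b \<and> J \<subseteq> I}
        \<subseteq> {K. K \<subseteq> A - J \<and> card K = b - card J}"
      using fJ by (auto simp: card_Diff_subset)
  qed auto
  then have "card {I. I \<subseteq> A \<and> card I = b \<and> J \<subseteq> I}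
      = card {K. K \<subseteq> A - J \<and> card K = b - card J}"
    by (simp add: bij_betw_same_card)
  also have "\<dots> = card (A - J) choose (b - card J)"
    using assms by (intro n_subsets) auto
  finally show ?thesis
    using assms fJ by (simp add: card_Diff_subset)
qed

text \<open>
  Expanding the square counts, for each pair \<open>(i, j)\<close>, the subsets that contain both indices. This
  count takes one value \<open>p\<close> on the diagonal and one value \<open>q\<close> off it, and since the vectors
  add up to zero the off-diagonal terms contribute \<open>-q\<close> times the sum of squares. Hence sampling
  without replacement is at least as good as independent sampling.
\<close>

lemma sum_square_over_subsets_le:
  fixes a :: "nat \<Rightarrow> 'a::real_inner"
  assumes b: "1 \<le> b" "b \<le> n" and zero: "(\<Sum>i=1..n. a i) = 0"
  shows "real n * (\<Sum>I | I \<subseteq> {1..n} \<and> card I = b. (norm (\<Sum>i\<in>I. a i))\<^sup>2)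
           \<le> real b * real (n choose b) * (\<Sum>i=1..n. (norm (a i))\<^sup>2)"
proof -
  define S where "S = {I. I \<subseteq> {1..n} \<and> card I = b}"
  have finS: "finite S"
    by (simp add: S_def)
  define cnt where "cnt i j = card {I \<in> S. i \<in> I \<and> j \<in> I}" for i j
  define p where "p = (n - 1) choose (b - 1)"
  define q where "q = (if 2 \<le> b then (n - 2) choose (b - 2) else 0)"
  have cnt_eq: "cnt i i = p" if "i \<in> {1..n}" for i
    using card_subsets_containing [of "{1..n}" "{i}" b] that b
    by (simp add: cnt_def S_def p_def conj_assoc)
  have cnt_neq: "cnt i j = q" if "i \<in> {1..n}" "j \<in> {1..n}" "i \<noteq> j" for i j
  proof (cases "2 \<le> b")
    case True
    then show ?thesis
      using card_subsets_containing [of "{1..n}" "{i, j}" b] that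
      by (simp add: cnt_def S_def q_def numeral_2_eq_2)
  next
    case False
    have "\<not> (i \<in> I \<and> j \<in> I)" if "I \<in> S" for I
    proof
      assume "i \<in> I \<and> j \<in> I"
      then have "card {i, j} \<le> card I"
        using that by (intro card_mono) (auto simp: S_def intro: finite_subset)
      then show False
        using that False \<open>i \<noteq> j\<close> by (simp add: S_def)
    qed
    then have none: "{I \<in> S. i \<in> I \<and> j \<in> I} = {}"
      by blast
    show ?thesis
      unfolding cnt_def none using False by (simp add: q_def)
  qed
  have cnt_ip: "real (cnt i j) * (a i \<bullet> a j)
      = real q * (a i \<bullet> a j) + (if i = j then (real p - real q) * (norm (a i))\<^sup>2 else 0)"
    if "i \<in> {1..n}" "j \<in> {1..n}" for i j
    using cnt_eq cnt_neq that by (cases "i = j") (auto simp: power2_norm_eq_inner algebra_simps)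
  have "(norm (\<Sum>i\<in>I. a i))\<^sup>2
      = (\<Sum>i=1..n. \<Sum>j=1..n. if i \<in> I \<and> j \<in> I then a i \<bullet> a j else 0)" if "I \<in> S" for I
  proof -
    have I: "I = {i \<in> {1..n}. i \<in> I}"
      using that by (auto simp: S_def)
    have "(norm (\<Sum>i\<in>I. a i))\<^sup>2 = (\<Sum>i\<in>I. \<Sum>j\<in>I. a i \<bullet> a j)"
      by (simp add: power2_norm_eq_inner inner_sum_left inner_sum_right) (rule sum.swap)
    also have "\<dots> = (\<Sum>i=1..n. if i \<in> I then (\<Sum>j=1..n. if j \<in> I then a i \<bullet> a j else 0) else 0)"
      by (subst (1 2) I) (simp only: sum.inter_filter finite_atLeastAtMost)
    also have "\<dots> = (\<Sum>i=1..n. \<Sum>j=1..n. if i \<in> I \<and> j \<in> I then a i \<bullet> a j else 0)"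
      by (intro sum.cong refl) auto
    finally show ?thesis .
  qed
  then have "(\<Sum>I\<in>S. (norm (\<Sum>i\<in>I. a i))\<^sup>2)
      = (\<Sum>I\<in>S. \<Sum>i=1..n. \<Sum>j=1..n. if i \<in> I \<and> j \<in> I then a i \<bullet> a j else 0)"
    by simp
  also have "\<dots> = (\<Sum>i=1..n. \<Sum>I\<in>S. \<Sum>j=1..n. if i \<in> I \<and> j \<in> I then a i \<bullet> a j else 0)"
    by (rule sum.swap)
  also have "\<dots> = (\<Sum>i=1..n. \<Sum>j=1..n. \<Sum>I\<in>S. if i \<in> I \<and> j \<in> I then a i \<bullet> a j else 0)"
    by (intro sum.cong refl) (rule sum.swap)
  also have "\<dots> = (\<Sum>i=1..n. \<Sum>j=1..n. real (cnt i j) * (a i \<bullet> a j))"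
    using finS by (intro sum.cong refl) (simp add: sum.inter_filter [symmetric] cnt_def)
  also have "\<dots> = (\<Sum>i=1..n. \<Sum>j=1..n. real q * (a i \<bullet> a j)
      + (if i = j then (real p - real q) * (norm (a i))\<^sup>2 else 0))"
    using cnt_ip by (intro sum.cong refl) auto
  also have "\<dots> = real q * ((\<Sum>i=1..n. a i) \<bullet> (\<Sum>j=1..n. a j))
      + (real p - real q) * (\<Sum>i=1..n. (norm (a i))\<^sup>2)"
    by (simp add: sum.distrib inner_sum_left inner_sum_right sum_distrib_left)
      (rule sum.swap)
  also have "\<dots> \<le> real p * (\<Sum>i=1..n. (norm (a i))\<^sup>2)"
    unfolding zero by (simp add: mult_right_mono sum_nonneg)
  finally have "(\<Sum>I\<in>S. (norm (\<Sum>i\<in>I. a i))\<^sup>2) \<le> real p * (\<Sum>i=1..n. (norm (a i))\<^sup>2)" .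
  then have "real n * (\<Sum>I\<in>S. (norm (\<Sum>i\<in>I. a i))\<^sup>2)
      \<le> real n * (real p * (\<Sum>i=1..n. (norm (a i))\<^sup>2))"
    by (intro mult_left_mono) auto
  moreover have "real n * real p = real b * real (n choose b)"
    using times_binomial_minus1_eq [of b n] b
    by (simp add: p_def flip: of_nat_mult)
  ultimately show ?thesis
    unfolding S_def by (simp add: mult.assoc [symmetric])
qed

section \<open>Expectations over the random draws\<close>

lemma minibatch_support:
  assumes "b \<le> n"
  shows "{I. I \<subseteq> {1..n} \<and> card I = b} \<noteq> {}" and "finite {I. I \<subseteq> {1..n} \<and> card I = b}"
    and "set_pmf (minibatch n b) = {I. I \<subseteq> {1..n} \<and> card I = b}"
proof -
  show ne: "{I. I \<subseteq> {1..n} \<and> card I = b} \<noteq> {}"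
    using assms by (auto intro!: exI [of _ "{1..b}"])
  show fin: "finite {I. I \<subseteq> {1..n} \<and> card I = b}"
    by simp
  show "set_pmf (minibatch n b) = {I. I \<subseteq> {1..n} \<and> card I = b}"
    unfolding minibatch_def using ne fin by (rule set_pmf_of_set)
qed

lemma expectation_minibatch_1:
  fixes h :: "nat set \<Rightarrow> real"
  assumes "1 \<le> n"
  shows "measure_pmf.expectation (minibatch n 1) h = 1 / real n * (\<Sum>i=1..n. h {i})"
proof -
  have S: "{I. I \<subseteq> {1..n} \<and> card I = 1} = (\<lambda>i. {i}) ` {1..n}"
    by (auto simp: card_1_singleton_iff)
  have "measure_pmf.expectation (minibatch n 1) h
      = sum h ((\<lambda>i. {i}) ` {1..n}) / card ((\<lambda>i. {i}) ` {1..n})"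
    unfolding minibatch_def S using assms by (intro integral_pmf_of_set) auto
  also have "\<dots> = (\<Sum>i=1..n. h {i}) / real n"
    by (simp add: sum.reindex card_image)
  finally show ?thesis
    by simp
qed

text \<open>
  In an expectation of \<open>u\<^sub>N\<close> with geometric \<open>N\<close> the sum over \<open>k\<close> of the recurrence, weighted
  by the mass \<open>\<gamma>\<^sup>k (1 - \<gamma>)\<close>, telescopes up to the factor \<open>1 + 1 / B\<close>; this factor absorbs exactly
  the growth of \<open>v\<close>. Keeping the remainder \<open>\<gamma>\<^sup>K (u\<^sub>K + v\<^sub>K)\<close> makes the estimate hold for every
  truncation, so that no integrability has to be known beforehand.
\<close>

lemma geometric_weighted_recurrence:
  fixes u v :: "nat \<Rightarrow> real"
  assumes B: "0 < B" and \<gamma>: "\<gamma> = B / (B + 1)"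
    and rec: "\<And>k. u (Suc k) + v (Suc k) \<le> (1 - a) * u k + (1 + 1 / B) * v k + h"
  shows "(1 + B * a) * (\<Sum>k<K. \<gamma> ^ k * (1 - \<gamma>) * u k) + \<gamma> ^ K * (u K + v K)
           \<le> u 0 + v 0 + B * h * (1 - \<gamma> ^ K)"
proof (induction K)
  case 0
  then show ?case by simp
next
  case (Suc K)
  have \<gamma>1: "1 - \<gamma> = 1 / (B + 1)" and \<gamma>0: "0 \<le> \<gamma>"
    using B by (auto simp: \<gamma> field_simps)
  have "\<gamma> * (u (Suc K) + v (Suc K)) \<le> \<gamma> * ((1 - a) * u K + (1 + 1 / B) * v K + h)"
    by (rule mult_left_mono [OF rec \<gamma>0])
  then have "(1 + B * a) * ((1 - \<gamma>) * u K) + \<gamma> * (u (Suc K) + v (Suc K))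
      \<le> (1 + B * a) * ((1 - \<gamma>) * u K) + \<gamma> * ((1 - a) * u K + (1 + 1 / B) * v K + h)"
    by simp
  also have "\<dots> = u K + v K + B * h * (1 - \<gamma>)"
  proof -
    define r where "r = 1 / B"
    have r: "(1 - \<gamma>) * B = \<gamma>" "\<gamma> * r = 1 - \<gamma>"
      using B by (simp_all add: \<gamma> r_def field_simps)
    have "(1 + B * a) * ((1 - \<gamma>) * u K) + \<gamma> * ((1 - a) * u K + (1 + r) * v K + h)
        = (1 - \<gamma>) * u K + a * ((1 - \<gamma>) * B) * u K + \<gamma> * (1 - a) * u K + (\<gamma> + \<gamma> * r) * v K + \<gamma> * h"
      by (simp add: algebra_simps)
    also have "\<dots> = u K + v K + (1 - \<gamma>) * B * h"
      unfolding r by (simp add: algebra_simps)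
    finally show ?thesis
      by (simp add: r_def mult_ac)
  qed
  finally have "\<gamma> ^ K * ((1 + B * a) * ((1 - \<gamma>) * u K) + \<gamma> * (u (Suc K) + v (Suc K)))
      \<le> \<gamma> ^ K * (u K + v K + B * h * (1 - \<gamma>))"
    using \<gamma>0 by (intro mult_left_mono) auto
  with Suc show ?case
    by (simp add: algebra_simps)
qed

lemma nn_integral_geometric_le:
  fixes u :: "nat \<Rightarrow> real"
  assumes \<gamma>: "0 < \<gamma>" "\<gamma> < 1" and u: "\<And>k. 0 \<le> u k"
    and le: "\<And>K. (\<Sum>k<K. \<gamma> ^ k * (1 - \<gamma>) * u k) \<le> c"
  shows "(\<integral>\<^sup>+ k. ennreal (u k) \<partial>geometric_pmf (1 - \<gamma>)) \<le> ennreal c"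
proof -
  have "(\<integral>\<^sup>+ k. ennreal (u k) \<partial>geometric_pmf (1 - \<gamma>))
      = suminf (\<lambda>k. ennreal (\<gamma> ^ k * (1 - \<gamma>) * u k))"
    using \<gamma> u by (simp add: nn_integral_measure_pmf nn_integral_count_space_nat flip: ennreal_mult)
  also have "\<dots> \<le> ennreal c"
  proof (rule suminf_le_const [OF summableI])
    fix K
    show "(\<Sum>k<K. ennreal (\<gamma> ^ k * (1 - \<gamma>) * u k)) \<le> ennreal c"
      using \<gamma> u le [of K] by (subst sum_ennreal) (auto intro!: ennreal_leI)
  qed
  finally show ?thesis .
qed

section \<open>Smooth finite sums\<close>

locale smooth_finite_sum =
  fixes d n :: nat and f :: "nat \<Rightarrow> (nat \<Rightarrow>\<^sub>0 real) \<Rightarrow> real" and L :: real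
  assumes n_pos: "1 \<le> n" and L_pos: "0 < L"
    and differentiable: "\<And>i. i \<in> {1..n} \<Longrightarrow> f i differentiable_on Rn d"
    and lipschitz: "\<And>i x y. i \<in> {1..n} \<Longrightarrow> x \<in> Rn d \<Longrightarrow> y \<in> Rn d \<Longrightarrow>
      norm (grad (Rn d) (f i) x - grad (Rn d) (f i) y) \<le> L * norm (x - y)"
begin

abbreviation "V \<equiv> Rn d"
abbreviation "F \<equiv> avg_fun n f"
abbreviation "G i \<equiv> grad V (f i)"
abbreviation "GF \<equiv> grad V F"

lemma G_in_V: "i \<in> {1..n} \<Longrightarrow> x \<in> V \<Longrightarrow> G i x \<in> V"
  and has_derivative_G: "i \<in> {1..n} \<Longrightarrow> x \<in> V \<Longrightarrow> (f i has_derivative (\<lambda>h. G i x \<bullet> h)) (at x within V)"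
  using has_derivative_grad differentiable by (auto simp: differentiable_on_def)

lemma
  assumes x: "x \<in> V"
  shows GF_eq: "GF x = (1 / real n) *\<^sub>R (\<Sum>i=1..n. G i x)"
    and GF_in_V: "GF x \<in> V"
    and has_derivative_GF: "(F has_derivative (\<lambda>h. GF x \<bullet> h)) (at x within V)"
proof -
  let ?g = "(1 / real n) *\<^sub>R (\<Sum>i=1..n. G i x)"
  have V: "?g \<in> V"
    using G_in_V x by (intro subspace_scale subspace_sum subspace_Rn) auto
  have "((\<lambda>x. 1 / real n * (\<Sum>i=1..n. f i x)) has_derivative
      (\<lambda>h. 1 / real n * (\<Sum>i=1..n. G i x \<bullet> h))) (at x within V)"
    using has_derivative_G x by (intro has_derivative_mult_right has_derivative_sum) auto
  then have D: "(F has_derivative (\<lambda>h. ?g \<bullet> h)) (at x within V)"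
    by (simp add: avg_fun_def [abs_def] inner_sum_left)
  show eq: "GF x = ?g"
    by (rule grad_eqI [OF subspace_Rn x V D])
  show "GF x \<in> V" and "(F has_derivative (\<lambda>h. GF x \<bullet> h)) (at x within V)"
    unfolding eq by (fact V, fact D)
qed

lemma GF_lipschitz:
  assumes "x \<in> V" "y \<in> V"
  shows "norm (GF x - GF y) \<le> L * norm (x - y)"
proof -
  have "norm (GF x - GF y) = 1 / real n * norm (\<Sum>i=1..n. G i x - G i y)"
    using n_pos by (simp add: GF_eq assms sum_subtractf flip: scaleR_diff_right)
  also have "\<dots> \<le> 1 / real n * (\<Sum>i=1..n. L * norm (x - y))"
    using lipschitz assms by (intro mult_left_mono sum_norm_le) auto
  also have "\<dots> = L * norm (x - y)"
    using n_pos by simp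
  finally show ?thesis .
qed

text \<open>
  Restricted to the line through \<open>x\<close> and \<open>y\<close>, the derivative within \<open>V\<close> becomes an ordinary one, and
  the difference of the two sides is monotone along the segment.
\<close>

lemma F_quadratic_upper_bound:
  assumes x: "x \<in> V" and y: "y \<in> V"
  shows "F y \<le> F x + GF x \<bullet> (y - x) + L / 2 * (norm (y - x))\<^sup>2"
proof -
  define h where "h = y - x"
  have h: "h \<in> V"
    using x y by (simp add: h_def subspace_diff subspace_Rn)
  have line: "x + t *\<^sub>R h \<in> V" for t
    using x h by (simp add: subspace_add subspace_scale subspace_Rn)
  define \<psi> where "\<psi> t = F (x + t *\<^sub>R h) - t * (GF x \<bullet> h) - L / 2 * t\<^sup>2 * (norm h)\<^sup>2" for t
  have D: "(\<psi> has_real_derivative GF (x + t *\<^sub>R h) \<bullet> h - GF x \<bullet> h - L * t * (norm h)\<^sup>2) (at t)" for t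
  proof -
    have aff: "((\<lambda>t. x + t *\<^sub>R h) has_derivative (\<lambda>t. t *\<^sub>R h)) (at t within UNIV)"
      by (auto intro!: derivative_eq_intros)
    have "(F has_derivative (\<lambda>k. GF (x + t *\<^sub>R h) \<bullet> k)) (at (x + t *\<^sub>R h) within range (\<lambda>t. x + t *\<^sub>R h))"
      by (rule has_derivative_subset [OF has_derivative_GF]) (use line in auto)
    from has_derivative_in_compose [OF aff this]
    have "((\<lambda>t. F (x + t *\<^sub>R h)) has_real_derivative GF (x + t *\<^sub>R h) \<bullet> h) (at t)"
      by (simp add: has_field_derivative_def mult.commute [of _ "GF (x + t *\<^sub>R h) \<bullet> h"])
    then show ?thesis
      unfolding \<psi>_def by (auto intro!: derivative_eq_intros)
  qed
  have "\<psi> 1 \<le> \<psi> 0"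
  proof (rule DERIV_nonpos_imp_nonincreasing [where f = \<psi>])
    fix t :: real assume t: "0 \<le> t"
    have "(GF (x + t *\<^sub>R h) - GF x) \<bullet> h \<le> norm (GF (x + t *\<^sub>R h) - GF x) * norm h"
      by (rule norm_cauchy_schwarz)
    also have "\<dots> \<le> (L * norm (t *\<^sub>R h)) * norm h"
      using GF_lipschitz [OF line x, of t] by (intro mult_right_mono) auto
    also have "\<dots> = L * t * (norm h)\<^sup>2"
      using t by (simp add: power2_eq_square)
    finally show "\<exists>y. (\<psi> has_real_derivative y) (at t) \<and> y \<le> 0"
      using D [of t] by (intro exI conjI) (auto simp: inner_diff_left)
  qed simp
  then show ?thesis
    by (simp add: \<psi>_def h_def)
qed

lemma batch_grad_in_V: "I \<subseteq> {1..n} \<Longrightarrow> x \<in> V \<Longrightarrow> batch_grad V f I x \<in> V"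
  unfolding batch_grad_def
  using G_in_V by (intro subspace_scale subspace_sum subspace_Rn) auto

lemma batch_grad_full: "x \<in> V \<Longrightarrow> batch_grad V f {1..n} x = GF x"
  by (simp add: batch_grad_def GF_eq)

lemma batch_grad_variance:
  assumes b: "1 \<le> b" "b \<le> n" and x: "x \<in> V"
  shows "measure_pmf.expectation (minibatch n b) (\<lambda>I. (norm (batch_grad V f I x - GF x))\<^sup>2)
           \<le> grad_variance V n f x / real b"
proof -
  define S where "S = {I. I \<subseteq> {1..n} \<and> card I = b}"
  define a where "a i = G i x - GF x" for i
  have zero: "(\<Sum>i=1..n. a i) = 0"
    using n_pos unfolding a_def by (simp add: sum_subtractf GF_eq x sum_constant_scaleR del: sum_constant)
  have "batch_grad V f I x - GF x = (1 / real b) *\<^sub>R (\<Sum>i\<in>I. a i)" if "I \<in> S" for I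
    using that b
    by (simp add: batch_grad_def a_def sum_subtractf S_def sum_constant_scaleR scaleR_diff_right del: sum_constant)
  then have "(\<Sum>I\<in>S. (norm (batch_grad V f I x - GF x))\<^sup>2)
      = (\<Sum>I\<in>S. (norm (\<Sum>i\<in>I. a i))\<^sup>2) / (real b)\<^sup>2"
    by (simp add: sum_divide_distrib power_divide power_mult_distrib)
  moreover have "measure_pmf.expectation (minibatch n b) (\<lambda>I. (norm (batch_grad V f I x - GF x))\<^sup>2)
      = (\<Sum>I\<in>S. (norm (batch_grad V f I x - GF x))\<^sup>2) / real (card S)"
    unfolding minibatch_def S_def
    using minibatch_support [OF b(2)] by (intro integral_pmf_of_set) auto
  moreover have "card S = n choose b"
    unfolding S_def using n_subsets [of "{1..n}" b] by simp
  ultimately have "measure_pmf.expectation (minibatch n b) (\<lambda>I. (norm (batch_grad V f I x - GF x))\<^sup>2)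
      = (\<Sum>I\<in>S. (norm (\<Sum>i\<in>I. a i))\<^sup>2) / ((real b)\<^sup>2 * real (n choose b))"
    by simp
  also have "\<dots> \<le> real b * real (n choose b) * grad_variance V n f x / ((real b)\<^sup>2 * real (n choose b))"
  proof (rule divide_right_mono)
    have "real n * (\<Sum>I\<in>S. (norm (\<Sum>i\<in>I. a i))\<^sup>2)
        \<le> real n * (real b * real (n choose b) * grad_variance V n f x)"
      using sum_square_over_subsets_le [OF b zero] n_pos
      by (simp add: S_def grad_variance_def a_def)
    then show "(\<Sum>I\<in>S. (norm (\<Sum>i\<in>I. a i))\<^sup>2) \<le> real b * real (n choose b) * grad_variance V n f x"
      using n_pos by simp
  qed simp
  also have "\<dots> = grad_variance V n f x / real b"
    using b by (simp add: power2_eq_square)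
  finally show ?thesis .
qed

section \<open>One step of the inner loop\<close>

text \<open>
  The correction \<open>G i x - G i x0\<close> has mean \<open>GF x - GF x0\<close>, and its variance is at most its second
  moment, which the Lipschitz condition bounds by the distance to the snapshot.
\<close>

lemma stochastic_gradient_moments:
  fixes x x0 g
  assumes x: "x \<in> V" and x0: "x0 \<in> V"
  defines "p \<equiv> GF x - GF x0 + g"
  shows "(1 / real n) *\<^sub>R (\<Sum>i=1..n. G i x - G i x0 + g) = p"
    and "1 / real n * (\<Sum>i=1..n. (norm (G i x - G i x0 + g))\<^sup>2) \<le> (norm p)\<^sup>2 + L\<^sup>2 * (norm (x - x0))\<^sup>2"
proof -
  define w where "w i = G i x - G i x0" for i
  have w: "GF x - GF x0 = (1 / real n) *\<^sub>R (\<Sum>i=1..n. w i)"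
    by (simp add: w_def GF_eq x x0 sum_subtractf scaleR_diff_right)
  have "(1 / real n) *\<^sub>R (\<Sum>i=1..n. w i + g) = (GF x - GF x0) + g"
    using n_pos unfolding w by (simp add: sum.distrib scaleR_add_right sum_constant_scaleR del: sum_constant)
  then show mean: "(1 / real n) *\<^sub>R (\<Sum>i=1..n. G i x - G i x0 + g) = p"
    by (simp add: w_def p_def)
  have "1 / real n * (\<Sum>i=1..n. (norm (G i x - G i x0 + g))\<^sup>2)
      = (norm p)\<^sup>2 + 1 / real n * (\<Sum>i=1..n. (norm (G i x - G i x0 + g - p))\<^sup>2)"
    by (rule mean_square_decomposition [OF n_pos mean [symmetric]])
  also have "1 / real n * (\<Sum>i=1..n. (norm (G i x - G i x0 + g - p))\<^sup>2)
      = 1 / real n * (\<Sum>i=1..n. (norm (w i - (GF x - GF x0)))\<^sup>2)"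
    by (simp add: w_def p_def algebra_simps)
  also have "\<dots> \<le> 1 / real n * (\<Sum>i=1..n. (norm (w i))\<^sup>2)"
    using mean_square_decomposition [OF n_pos w] by simp
  also have "\<dots> \<le> 1 / real n * (\<Sum>i=1..n. (L * norm (x - x0))\<^sup>2)"
    using lipschitz x x0 unfolding w_def by (intro mult_left_mono sum_mono power_mono) auto
  also have "\<dots> = L\<^sup>2 * (norm (x - x0))\<^sup>2"
    using n_pos by (simp add: power_mult_distrib)
  finally show "1 / real n * (\<Sum>i=1..n. (norm (G i x - G i x0 + g))\<^sup>2)
      \<le> (norm p)\<^sup>2 + L\<^sup>2 * (norm (x - x0))\<^sup>2"
    by simp
qed

lemma mean_step:
  assumes x: "x \<in> V" and x0: "x0 \<in> V" and g: "g \<in> V" and \<eta>: "0 \<le> \<eta>"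
  defines "p \<equiv> GF x - GF x0 + g"
    and "x' \<equiv> \<lambda>i. x - \<eta> *\<^sub>R (G i x - G i x0 + g)"
  shows mean_step_F: "1 / real n * (\<Sum>i=1..n. F (x' i))
      \<le> F x - \<eta> * (GF x \<bullet> p) + L / 2 * \<eta>\<^sup>2 * ((norm p)\<^sup>2 + L\<^sup>2 * (norm (x - x0))\<^sup>2)"
    and mean_step_distance: "1 / real n * (\<Sum>i=1..n. (norm (x' i - x0))\<^sup>2)
      \<le> (norm (x - x0))\<^sup>2 - 2 * \<eta> * (p \<bullet> (x - x0)) + \<eta>\<^sup>2 * ((norm p)\<^sup>2 + L\<^sup>2 * (norm (x - x0))\<^sup>2)"
proof -
  define \<nu> where "\<nu> i = G i x - G i x0 + g" for i
  define M where "M = 1 / real n * (\<Sum>i=1..n. (norm (\<nu> i))\<^sup>2)"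
  have mean: "(1 / real n) *\<^sub>R (\<Sum>i=1..n. \<nu> i) = p"
    and M: "M \<le> (norm p)\<^sup>2 + L\<^sup>2 * (norm (x - x0))\<^sup>2"
    unfolding M_def \<nu>_def p_def by (rule stochastic_gradient_moments [OF x x0])+
  have mean_inner: "1 / real n * (\<Sum>i=1..n. y \<bullet> \<nu> i) = y \<bullet> p" for y
    by (simp add: inner_sum_right flip: mean)
  have x'_eq: "x' i = x - \<eta> *\<^sub>R \<nu> i" for i
    by (simp add: x'_def \<nu>_def)
  have \<nu>V: "\<nu> i \<in> V" if "i \<in> {1..n}" for i
    using that x x0 g G_in_V by (simp add: \<nu>_def subspace_add subspace_diff subspace_Rn)
  have "F (x' i) \<le> F x - \<eta> * (GF x \<bullet> \<nu> i) + L / 2 * \<eta>\<^sup>2 * (norm (\<nu> i))\<^sup>2" if "i \<in> {1..n}" for i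
  proof -
    have "x' i \<in> V"
      using x \<nu>V [OF that] by (simp add: x'_eq subspace_diff subspace_scale subspace_Rn)
    from F_quadratic_upper_bound [OF x this] show ?thesis
      by (simp add: x'_eq power_mult_distrib)
  qed
  then have "1 / real n * (\<Sum>i=1..n. F (x' i))
      \<le> 1 / real n * (\<Sum>i=1..n. F x - \<eta> * (GF x \<bullet> \<nu> i) + L / 2 * \<eta>\<^sup>2 * (norm (\<nu> i))\<^sup>2)"
    by (intro mult_left_mono sum_mono) auto
  also have "\<dots> = F x - \<eta> * (1 / real n * (\<Sum>i=1..n. GF x \<bullet> \<nu> i)) + L / 2 * \<eta>\<^sup>2 * M"
    using n_pos unfolding M_def sum.distrib sum_subtractf sum_distrib_left [symmetric]
    by (simp add: algebra_simps)
  also have "\<dots> \<le> F x - \<eta> * (GF x \<bullet> p) + L / 2 * \<eta>\<^sup>2 * ((norm p)\<^sup>2 + L\<^sup>2 * (norm (x - x0))\<^sup>2)"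
    unfolding mean_inner using L_pos by (intro add_left_mono mult_left_mono M) auto
  finally show "1 / real n * (\<Sum>i=1..n. F (x' i))
      \<le> F x - \<eta> * (GF x \<bullet> p) + L / 2 * \<eta>\<^sup>2 * ((norm p)\<^sup>2 + L\<^sup>2 * (norm (x - x0))\<^sup>2)" .
  have "(norm (x' i - x0))\<^sup>2 = (norm (x - x0))\<^sup>2 - 2 * \<eta> * ((x - x0) \<bullet> \<nu> i) + \<eta>\<^sup>2 * (norm (\<nu> i))\<^sup>2" for i
  proof -
    have "x' i - x0 = (x - x0) - \<eta> *\<^sub>R \<nu> i"
      by (simp add: x'_eq)
    then have "(norm (x' i - x0))\<^sup>2
        = (norm (x - x0))\<^sup>2 - 2 * ((x - x0) \<bullet> (\<eta> *\<^sub>R \<nu> i)) + (norm (\<eta> *\<^sub>R \<nu> i))\<^sup>2"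
      by (simp only: power2_norm_eq_inner)
        (simp add: inner_diff_left inner_diff_right inner_commute)
    then show ?thesis
      by (simp add: power_mult_distrib)
  qed
  then have "1 / real n * (\<Sum>i=1..n. (norm (x' i - x0))\<^sup>2) = 1 / real n *
      (\<Sum>i=1..n. (norm (x - x0))\<^sup>2 - 2 * \<eta> * ((x - x0) \<bullet> \<nu> i) + \<eta>\<^sup>2 * (norm (\<nu> i))\<^sup>2)"
    by presburger
  also have "\<dots> = (norm (x - x0))\<^sup>2 - 2 * \<eta> * (1 / real n * (\<Sum>i=1..n. (x - x0) \<bullet> \<nu> i)) + \<eta>\<^sup>2 * M"
    using n_pos unfolding M_def sum.distrib sum_subtractf sum_distrib_left [symmetric]
    by (simp add: field_simps del: inner_diff_left)
  also have "\<dots> \<le> (norm (x - x0))\<^sup>2 - 2 * \<eta> * (p \<bullet> (x - x0))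
      + \<eta>\<^sup>2 * ((norm p)\<^sup>2 + L\<^sup>2 * (norm (x - x0))\<^sup>2)"
    unfolding mean_inner by (subst inner_commute) (intro add_left_mono mult_left_mono M, auto)
  finally show "1 / real n * (\<Sum>i=1..n. (norm (x' i - x0))\<^sup>2)
      \<le> (norm (x - x0))\<^sup>2 - 2 * \<eta> * (p \<bullet> (x - x0)) + \<eta>\<^sup>2 * ((norm p)\<^sup>2 + L\<^sup>2 * (norm (x - x0))\<^sup>2)" .
qed


text \<open>
  Let \<open>p = GF x - GF x0 + g\<close>, the mean of the random step direction. Since
  \<open>p - GF x = g - GF x0\<close> is the error of the snapshot gradient, polarisation turns
  \<open>GF x \<bullet> p\<close> into \<open>(norm p)\<^sup>2 + (norm (GF x))\<^sup>2\<close> minus the squared error, halved. The term in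
  \<open>(norm p)\<^sup>2\<close> is then available to pay for the quadratic terms and for the drift of the distance,
  split by Young's inequality with weight \<open>t / (3 L) = 2 \<eta> t\<^sup>3\<close>. With \<open>t\<^sup>3\<close> the batch size, the
  squared distance to the snapshot grows by at most the factor \<open>1 + 1 / t\<^sup>3\<close>, which is what the
  geometric length of the inner loop tolerates. The weight \<open>c\<close> of the distance has to be large enough
  for this growth to cover the distance term \<open>L\<^sup>3 \<eta>\<^sup>2 / 2\<close> of the bound on \<open>F\<close>, and small enough for
  \<open>(norm p)\<^sup>2\<close> to pay for it; \<open>L / (4 t)\<close> meets both demands with room to spare.
\<close>

lemma lyapunov_step:
  fixes t \<eta> c :: real
  assumes x: "x \<in> V" and x0: "x0 \<in> V" and g: "g \<in> V" and t: "2 \<le> t"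
    and \<eta>: "\<eta> = 1 / (6 * L * t\<^sup>2)" and c: "c = L / (4 * t)"
  shows "1 / real n * (\<Sum>i=1..n. F (x - \<eta> *\<^sub>R (G i x - G i x0 + g)))
      + c * (1 / real n * (\<Sum>i=1..n. (norm (x - \<eta> *\<^sub>R (G i x - G i x0 + g) - x0))\<^sup>2))
    \<le> F x + c * (1 + 1 / t ^ 3) * (norm (x - x0))\<^sup>2
      - \<eta> / 2 * (norm (GF x))\<^sup>2 + \<eta> / 2 * (norm (g - GF x0))\<^sup>2"
proof -
  define p where "p = GF x - GF x0 + g"
  define Q where "Q = (norm p)\<^sup>2"
  define D where "D = (norm (x - x0))\<^sup>2"
  define \<Gamma> where "\<Gamma> = (norm (GF x))\<^sup>2"
  define W where "W = (norm (g - GF x0))\<^sup>2"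
  define \<beta> where "\<beta> = t / (3 * L)"
  have pos: "0 < \<eta>" "0 < c" "0 < \<beta>" "0 < t"
    using t L_pos by (auto simp: \<eta> c \<beta>_def)
  have "g - GF x0 = p - GF x"
    by (simp add: p_def)
  then have polar: "GF x \<bullet> p = (Q + \<Gamma> - W) / 2"
    by (simp add: Q_def \<Gamma>_def W_def power2_norm_eq_inner inner_diff_left inner_diff_right
        inner_commute)
  have "0 \<le> (norm (\<beta> *\<^sub>R p + (x - x0)))\<^sup>2"
    by simp
  also have "\<dots> = \<beta>\<^sup>2 * Q + 2 * \<beta> * (p \<bullet> (x - x0)) + D"
    by (simp only: power2_norm_eq_inner Q_def D_def inner_add_left inner_add_right
        inner_scaleR_left inner_scaleR_right inner_commute [of "x - x0" p])
      (simp add: power2_eq_square algebra_simps)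
  finally have young: "- 2 * (p \<bullet> (x - x0)) \<le> \<beta> * Q + D / \<beta>"
    using pos by (simp add: field_simps power2_eq_square)
  have t2: "1 / t\<^sup>2 \<le> 1 / 4" and t3: "1 / t ^ 3 \<le> 1 / 8"
    using power_mono [OF t, of 2] power_mono [OF t, of 3] t by (simp_all add: field_simps)
  have coeff_Q: "- (\<eta> / 2) + L / 2 * \<eta>\<^sup>2 + c * (\<eta>\<^sup>2 + \<eta> * \<beta>) \<le> 0"
  proof -
    have "L * \<eta> = 1 / 6 * (1 / t\<^sup>2)" "c * \<eta> = 1 / 24 * (1 / t ^ 3)" "c * \<beta> = 1 / 12"
      using L_pos pos(4) by (auto simp: \<eta> c \<beta>_def field_simps power2_eq_square power3_eq_cube)
    then have "- 1 / 2 + L * \<eta> / 2 + c * \<eta> + c * \<beta> \<le> 0"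
      using t2 t3 by simp
    then have "\<eta> * (- 1 / 2 + L * \<eta> / 2 + c * \<eta> + c * \<beta>) \<le> 0"
      using pos by (simp add: mult_le_0_iff)
    then show ?thesis
      by (simp add: algebra_simps power2_eq_square)
  qed
  have coeff_D: "L / 2 * \<eta>\<^sup>2 * L\<^sup>2 + c * (1 + \<eta> / \<beta> + \<eta>\<^sup>2 * L\<^sup>2) \<le> c * (1 + 1 / t ^ 3)"
  proof -
    have "L / 2 * \<eta>\<^sup>2 * L\<^sup>2 = c * (1 / 18 * (1 / t ^ 3))" and e1: "\<eta> / \<beta> = 1 / 2 * (1 / t ^ 3)"
      and e2: "\<eta>\<^sup>2 * L\<^sup>2 = 1 / 36 * (1 / t) * (1 / t ^ 3)"
      using L_pos pos(4)
      by (auto simp: \<eta> c \<beta>_def field_simps power2_eq_square power3_eq_cube)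
    then have "L / 2 * \<eta>\<^sup>2 * L\<^sup>2 + c * (1 + \<eta> / \<beta> + \<eta>\<^sup>2 * L\<^sup>2)
        = c * (1 + (1 / 18 + 1 / 2 + 1 / 36 * (1 / t)) * (1 / t ^ 3))"
      by (simp add: algebra_simps)
    also have "\<dots> \<le> c * (1 + 1 * (1 / t ^ 3))"
      using pos t by (intro mult_left_mono add_left_mono mult_right_mono) (auto simp: field_simps)
    finally show ?thesis
      by simp
  qed
  have "1 / real n * (\<Sum>i=1..n. F (x - \<eta> *\<^sub>R (G i x - G i x0 + g)))
      \<le> F x - \<eta> * ((Q + \<Gamma> - W) / 2) + L / 2 * \<eta>\<^sup>2 * (Q + L\<^sup>2 * D)"
    using mean_step_F [OF x x0 g, of \<eta>] pos unfolding p_def [symmetric]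
    by (simp add: polar Q_def D_def)
  moreover have "1 / real n * (\<Sum>i=1..n. (norm (x - \<eta> *\<^sub>R (G i x - G i x0 + g) - x0))\<^sup>2)
      \<le> D + \<eta> * (\<beta> * Q + D / \<beta>) + \<eta>\<^sup>2 * (Q + L\<^sup>2 * D)"
    using mean_step_distance [OF x x0 g, of \<eta>] mult_left_mono [OF young, of \<eta>] pos
    unfolding p_def [symmetric] Q_def D_def by (simp add: mult_ac)
  ultimately have "1 / real n * (\<Sum>i=1..n. F (x - \<eta> *\<^sub>R (G i x - G i x0 + g)))
      + c * (1 / real n * (\<Sum>i=1..n. (norm (x - \<eta> *\<^sub>R (G i x - G i x0 + g) - x0))\<^sup>2))
      \<le> F x - \<eta> * ((Q + \<Gamma> - W) / 2) + L / 2 * \<eta>\<^sup>2 * (Q + L\<^sup>2 * D)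
        + c * (D + \<eta> * (\<beta> * Q + D / \<beta>) + \<eta>\<^sup>2 * (Q + L\<^sup>2 * D))"
    using pos by (intro add_mono mult_left_mono) auto
  also have "\<dots> = F x - \<eta> / 2 * \<Gamma> + \<eta> / 2 * W
      + (- (\<eta> / 2) + L / 2 * \<eta>\<^sup>2 + c * (\<eta>\<^sup>2 + \<eta> * \<beta>)) * Q
      + (L / 2 * \<eta>\<^sup>2 * L\<^sup>2 + c * (1 + \<eta> / \<beta> + \<eta>\<^sup>2 * L\<^sup>2)) * D"
    by (simp add: field_simps)
  also have "\<dots> \<le> F x - \<eta> / 2 * \<Gamma> + \<eta> / 2 * W + 0 * Q + c * (1 + 1 / t ^ 3) * D"
    by (intro add_mono mult_right_mono coeff_Q coeff_D order_refl) (auto simp: Q_def D_def)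
  finally show ?thesis
    by (simp add: D_def \<Gamma>_def W_def)
qed

section \<open>The inner loop and the epoch\<close>

lemma
  assumes "x0 \<in> V" "g \<in> V"
  shows inner_in_V: "set_pmf (scsg_inner V n f 1 \<eta> x0 g k) \<subseteq> V"
    and inner_finite: "finite (set_pmf (scsg_inner V n f 1 \<eta> x0 g k))"
proof (induction k)
  case (Suc k)
  {
    case 1
    show ?case
      using Suc assms minibatch_support(3) [of 1 n] n_pos
      by (auto intro!: subspace_diff subspace_add subspace_scale subspace_Rn batch_grad_in_V)
  next
    case 2
    show ?case
      using Suc minibatch_support [of 1 n] n_pos by auto
  }
qed (use assms in auto)

lemma expectation_inner_Suc:
  fixes h :: "(nat \<Rightarrow>\<^sub>0 real) \<Rightarrow> real"
  assumes "x0 \<in> V" "g \<in> V"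
  shows "measure_pmf.expectation (scsg_inner V n f 1 \<eta> x0 g (Suc k)) h
    = measure_pmf.expectation (scsg_inner V n f 1 \<eta> x0 g k)
        (\<lambda>x. 1 / real n * (\<Sum>i=1..n. h (x - \<eta> *\<^sub>R (G i x - G i x0 + g))))"
proof -
  let ?P = "scsg_inner V n f 1 \<eta> x0 g k"
  let ?next = "\<lambda>x I. x - \<eta> *\<^sub>R (batch_grad V f I x - batch_grad V f I x0 + g)"
  have fin: "finite (set_pmf ?P)"
    by (rule inner_finite [OF assms])
  have fin_batch: "finite (set_pmf (minibatch n 1))"
    using minibatch_support [of 1 n] n_pos by simp
  have "measure_pmf.expectation (scsg_inner V n f 1 \<eta> x0 g (Suc k)) h
      = measure_pmf.expectation (?P \<bind> (\<lambda>x. map_pmf (?next x) (minibatch n 1))) h"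
    by (simp add: map_pmf_def)
  also have "\<dots> = (\<Sum>x\<in>set_pmf ?P. pmf ?P x *\<^sub>R
      measure_pmf.expectation (map_pmf (?next x) (minibatch n 1)) h)"
    using fin fin_batch by (intro pmf_expectation_bind) auto
  also have "\<dots> = (\<Sum>x\<in>set_pmf ?P. pmf ?P x *\<^sub>R
      (1 / real n * (\<Sum>i=1..n. h (x - \<eta> *\<^sub>R (G i x - G i x0 + g)))))"
    using n_pos by (simp only: integral_map_pmf expectation_minibatch_1) (simp add: batch_grad_def)
  also have "\<dots> = measure_pmf.expectation ?P
      (\<lambda>x. 1 / real n * (\<Sum>i=1..n. h (x - \<eta> *\<^sub>R (G i x - G i x0 + g))))"
    using fin by (intro integral_measure_pmf [symmetric]) auto
  finally show ?thesis .
qed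

end

locale pl_finite_sum = smooth_finite_sum +
  fixes xs :: "nat \<Rightarrow>\<^sub>0 real" and \<mu> :: real
  assumes minimum: "\<And>x. x \<in> Rn d \<Longrightarrow> avg_fun n f xs \<le> avg_fun n f x"
    and \<mu>_pos: "0 < \<mu>"
    and PL: "\<And>x. x \<in> Rn d \<Longrightarrow>
      2 * \<mu> * (avg_fun n f x - avg_fun n f xs) \<le> (norm (grad (Rn d) (avg_fun n f) x))\<^sup>2"
begin

abbreviation "err x \<equiv> F x - F xs"

text \<open>
  The Polyak-Lojasiewicz condition turns the decrease by the squared gradient norm into a decrease
  proportional to the error itself.
\<close>

lemma inner_recurrence:
  fixes t \<eta> c :: real
  assumes x0: "x0 \<in> V" and g: "g \<in> V" and t: "2 \<le> t"
    and \<eta>: "\<eta> = 1 / (6 * L * t\<^sup>2)" and c: "c = L / (4 * t)"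
  defines "u \<equiv> \<lambda>k. measure_pmf.expectation (scsg_inner V n f 1 \<eta> x0 g k) err"
    and "v \<equiv> \<lambda>k. c * measure_pmf.expectation (scsg_inner V n f 1 \<eta> x0 g k) (\<lambda>x. (norm (x - x0))\<^sup>2)"
  shows "u (Suc k) + v (Suc k)
    \<le> (1 - \<eta> * \<mu>) * u k + (1 + 1 / t ^ 3) * v k + \<eta> / 2 * (norm (g - GF x0))\<^sup>2"
proof -
  let ?P = "scsg_inner V n f 1 \<eta> x0 g k"
  define x' where "x' x i = x - \<eta> *\<^sub>R (G i x - G i x0 + g)" for x i
  have int: "integrable (measure_pmf ?P) h" for h :: "_ \<Rightarrow> real"
    by (rule integrable_measure_pmf_finite [OF inner_finite [OF x0 g]])
  have step: "1 / real n * (\<Sum>i=1..n. err (x' x i)) + c * (1 / real n * (\<Sum>i=1..n. (norm (x' x i - x0))\<^sup>2))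
      \<le> (1 - \<eta> * \<mu>) * err x + (1 + 1 / t ^ 3) * (c * (norm (x - x0))\<^sup>2)
        + \<eta> / 2 * (norm (g - GF x0))\<^sup>2"
    if x: "x \<in> V" for x
  proof -
    have "1 / real n * (\<Sum>i=1..n. err (x' x i)) = 1 / real n * (\<Sum>i=1..n. F (x' x i)) - F xs"
      using n_pos by (simp add: sum_subtractf field_simps)
    moreover have "\<eta> / 2 * (2 * \<mu> * err x) \<le> \<eta> / 2 * (norm (GF x))\<^sup>2"
      using L_pos by (intro mult_left_mono PL x) (simp add: \<eta>)
    moreover note lyapunov_step [OF x x0 g t \<eta> c, folded x'_def]
    ultimately show ?thesis
      by (simp add: algebra_simps)
  qed
  have "u (Suc k) + v (Suc k) = measure_pmf.expectation ?P (\<lambda>x.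
      1 / real n * (\<Sum>i=1..n. err (x' x i)) + c * (1 / real n * (\<Sum>i=1..n. (norm (x' x i - x0))\<^sup>2)))"
    unfolding u_def v_def expectation_inner_Suc [OF x0 g] x'_def [symmetric]
    by (subst Bochner_Integration.integral_add [OF int int]) (simp add: int)
  also have "\<dots> \<le> measure_pmf.expectation ?P (\<lambda>x. (1 - \<eta> * \<mu>) * err x
      + (1 + 1 / t ^ 3) * (c * (norm (x - x0))\<^sup>2) + \<eta> / 2 * (norm (g - GF x0))\<^sup>2)"
    using step inner_in_V [OF x0 g]
    by (intro integral_mono_AE int) (auto simp: AE_measure_pmf_iff)
  also have "\<dots> = (1 - \<eta> * \<mu>) * u k + (1 + 1 / t ^ 3) * v k + \<eta> / 2 * (norm (g - GF x0))\<^sup>2"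
    unfolding u_def v_def
    by (simp only: Bochner_Integration.integral_add [OF int int] integral_mult_right_zero
        lebesgue_integral_const measure_pmf.prob_space)
      simp
  finally show ?thesis .
qed

lemma nn_integral_inner_geometric:
  fixes B :: nat and t \<eta> :: real
  assumes x: "x \<in> V" and g: "g \<in> V" and t: "2 \<le> t" and B: "real B = t ^ 3"
    and \<eta>: "\<eta> = 1 / (6 * L * t\<^sup>2)"
  shows "(\<integral>\<^sup>+ N. \<integral>\<^sup>+ y. ennreal (err y) \<partial>scsg_inner V n f 1 \<eta> x g N
      \<partial>geometric_pmf (1 - real B / real (B + 1)))
    \<le> ennreal ((err x + real B * \<eta> / 2 * (norm (g - GF x))\<^sup>2) / (1 + real B * \<eta> * \<mu>))"
proof -
  define c where "c = L / (4 * t)"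
  define \<gamma> where "\<gamma> = real B / (real B + 1)"
  define u where "u k = measure_pmf.expectation (scsg_inner V n f 1 \<eta> x g k) err" for k
  define v where "v k = c * measure_pmf.expectation (scsg_inner V n f 1 \<eta> x g k)
      (\<lambda>y. (norm (y - x))\<^sup>2)" for k
  define w where "w = (norm (g - GF x))\<^sup>2"
  have pos: "0 < real B" "0 < c" "0 < \<eta>"
    using t L_pos by (auto simp: B c_def \<eta>)
  then have \<gamma>: "0 < \<gamma>" "\<gamma> < 1"
    by (auto simp: \<gamma>_def field_simps)
  have err_nonneg: "AE y in measure_pmf (scsg_inner V n f 1 \<eta> x g k). 0 \<le> err y" for k
    using inner_in_V [OF x g] minimum by (force simp: AE_measure_pmf_iff)
  have u: "0 \<le> u k" for k
    unfolding u_def by (rule integral_nonneg_AE [OF err_nonneg])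
  have v: "0 \<le> v k" for k
    unfolding v_def using pos by simp
  have "u (Suc k) + v (Suc k) \<le> (1 - \<eta> * \<mu>) * u k + (1 + 1 / real B) * v k + \<eta> / 2 * w" for k
    unfolding u_def v_def w_def B by (rule inner_recurrence [OF x g t \<eta> c_def])
  note sum = geometric_weighted_recurrence [of "real B" \<gamma> u v, OF pos(1) \<gamma>_def this]
  have "(\<Sum>k<K. \<gamma> ^ k * (1 - \<gamma>) * u k) \<le> (err x + real B * \<eta> / 2 * w) / (1 + real B * \<eta> * \<mu>)" for K
  proof -
    have "0 \<le> \<gamma> ^ K * (u K + v K)"
      using \<gamma> u v by simp
    moreover have "real B * (\<eta> / 2 * w) * (1 - \<gamma> ^ K) \<le> real B * (\<eta> / 2 * w) * 1"
      using \<gamma> pos by (intro mult_left_mono) (auto simp: w_def)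
    moreover have "u 0 = err x" "v 0 = 0"
      by (auto simp: u_def v_def)
    ultimately have "(1 + real B * (\<eta> * \<mu>)) * (\<Sum>k<K. \<gamma> ^ k * (1 - \<gamma>) * u k) \<le> err x + real B * (\<eta> / 2 * w)"
      using sum [of K] by simp
    moreover have "0 < 1 + real B * \<eta> * \<mu>"
      using pos \<mu>_pos by (intro add_pos_nonneg) auto
    ultimately show ?thesis
      by (simp add: field_simps)
  qed
  then have "(\<integral>\<^sup>+ N. ennreal (u N) \<partial>geometric_pmf (1 - \<gamma>))
      \<le> ennreal ((err x + real B * \<eta> / 2 * w) / (1 + real B * \<eta> * \<mu>))"
    by (intro nn_integral_geometric_le \<gamma> u)
  moreover have "(\<integral>\<^sup>+ y. ennreal (err y) \<partial>scsg_inner V n f 1 \<eta> x g N) = ennreal (u N)" for N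
    unfolding u_def
    by (intro nn_integral_eq_integral err_nonneg integrable_measure_pmf_finite inner_finite x g)
  ultimately show ?thesis
    by (simp add: \<gamma>_def w_def add.commute)
qed

text \<open>
  The bound for a given snapshot gradient is affine in its squared error, so averaging over the batch
  only replaces this error by its mean.
\<close>

lemma epoch_contraction:
  fixes B :: nat and t \<eta> W :: real
  assumes x: "x \<in> V" and t: "2 \<le> t" and B: "real B = t ^ 3" "B \<le> n"
    and \<eta>: "\<eta> = 1 / (6 * L * t\<^sup>2)"
    and W: "measure_pmf.expectation (minibatch n B) (\<lambda>I. (norm (batch_grad V f I x - GF x))\<^sup>2) \<le> W"
  shows "(\<integral>\<^sup>+ (y, c). ennreal (err y) \<partial>scsg_epoch V n f B 1 \<eta> x)
    \<le> ennreal ((err x + real B * \<eta> / 2 * W) / (1 + real B * \<eta> * \<mu>))"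
proof -
  let ?e = "\<lambda>I. (norm (batch_grad V f I x - GF x))\<^sup>2"
  let ?b = "\<lambda>w. (err x + real B * \<eta> / 2 * w) / (1 + real B * \<eta> * \<mu>)"
  note support = minibatch_support [OF B(2)]
  have \<eta>0: "0 \<le> \<eta>"
    using L_pos by (simp add: \<eta>)
  have b_nonneg: "0 \<le> ?b w" if "0 \<le> w" for w
    using that minimum [OF x] \<eta>0 \<mu>_pos by (intro divide_nonneg_nonneg add_nonneg_nonneg) auto
  have int: "integrable (measure_pmf (minibatch n B)) h" for h :: "_ \<Rightarrow> real"
    using support by (intro integrable_measure_pmf_finite) simp
  have "(\<integral>\<^sup>+ (y, c). ennreal (err y) \<partial>scsg_epoch V n f B 1 \<eta> x)
      = (\<integral>\<^sup>+ I. \<integral>\<^sup>+ N. \<integral>\<^sup>+ y. ennreal (err y) \<partial>scsg_inner V n f 1 \<eta> x (batch_grad V f I x) N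
          \<partial>geometric_pmf (1 - real B / real (B + 1)) \<partial>minibatch n B)"
    by (simp add: scsg_epoch_def)
  also have "\<dots> \<le> (\<integral>\<^sup>+ I. ennreal (?b (?e I)) \<partial>minibatch n B)"
  proof (intro nn_integral_mono_AE, unfold AE_measure_pmf_iff, rule ballI)
    fix I assume "I \<in> set_pmf (minibatch n B)"
    then have "batch_grad V f I x \<in> V"
      using support x by (intro batch_grad_in_V) auto
    then show "(\<integral>\<^sup>+ N. \<integral>\<^sup>+ y. ennreal (err y) \<partial>scsg_inner V n f 1 \<eta> x (batch_grad V f I x) N
        \<partial>geometric_pmf (1 - real B / real (B + 1))) \<le> ennreal (?b (?e I))"
      by (rule nn_integral_inner_geometric [OF x _ t B(1) \<eta>])
  qed
  also have "\<dots> = ennreal (measure_pmf.expectation (minibatch n B) (\<lambda>I. ?b (?e I)))"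
    using b_nonneg by (intro nn_integral_eq_integral int) auto
  also have "measure_pmf.expectation (minibatch n B) (\<lambda>I. ?b (?e I))
      = ?b (measure_pmf.expectation (minibatch n B) ?e)"
    by (simp add: int)
  also have "ennreal \<dots> \<le> ennreal (?b W)"
    using \<eta>0 \<mu>_pos by (intro ennreal_leI divide_right_mono add_left_mono mult_left_mono W) auto
  finally show ?thesis .
qed

lemma scsg_in_V:
  assumes "x0 \<in> V" "B \<le> n" "xc \<in> set_pmf (scsg V n f (\<lambda>_. B) (\<lambda>_. 1) (\<lambda>_. \<eta>) x0 T)"
  shows "fst xc \<in> V"
  using assms(3)
proof (induction T arbitrary: xc)
  case 0
  then show ?case
    using assms(1) by simp
next
  case (Suc T)
  then obtain x c I N where "(x, c) \<in> set_pmf (scsg V n f (\<lambda>_. B) (\<lambda>_. 1) (\<lambda>_. \<eta>) x0 T)"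
    and I: "I \<in> set_pmf (minibatch n B)"
    and y: "fst xc \<in> set_pmf (scsg_inner V n f 1 \<eta> x (batch_grad V f I x) N)"
    by (fastforce simp: scsg_epoch_def)
  then have x: "x \<in> V"
    using Suc.IH by force
  moreover have "batch_grad V f I x \<in> V"
    using I x minibatch_support(3) [OF assms(2)] by (intro batch_grad_in_V) auto
  ultimately show ?case
    using y inner_in_V by blast
qed

text \<open>
  The number \<open>\<delta>\<close> is the fixed point of the map \<open>a \<mapsto> (a + s \<delta>) / (1 + s)\<close>, which bounds the effect of
  an epoch on the expected error, so the excess over \<open>\<delta>\<close> shrinks by the factor \<open>1 + s\<close> each time.
  Working in \<^typ>\<open>ennreal\<close> spares the integrability of the error.
\<close>

lemma scsg_error:
  fixes s \<delta> :: real
  assumes x0: "x0 \<in> V" and B: "B \<le> n" and s: "0 \<le> s" and \<delta>: "0 \<le> \<delta>"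
    and epoch: "\<And>x. x \<in> V \<Longrightarrow>
      (\<integral>\<^sup>+ (y, c). ennreal (err y) \<partial>scsg_epoch V n f B 1 \<eta> x) \<le> ennreal ((err x + s * \<delta>) / (1 + s))"
  shows "(\<integral>\<^sup>+ (x, c). ennreal (err x) \<partial>scsg V n f (\<lambda>_. B) (\<lambda>_. 1) (\<lambda>_. \<eta>) x0 T)
    \<le> ennreal (\<delta> + err x0 / (1 + s) ^ T)"
proof (induction T)
  case 0
  then show ?case
    using \<delta> by (simp add: ennreal_leI)
next
  case (Suc T)
  let ?P = "scsg V n f (\<lambda>_. B) (\<lambda>_. 1) (\<lambda>_. \<eta>) x0 T"
  have in_V: "fst xc \<in> V" if "xc \<in> set_pmf ?P" for xc
    by (rule scsg_in_V [OF x0 B that])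
  have "(\<integral>\<^sup>+ (x, c). ennreal (err x) \<partial>scsg V n f (\<lambda>_. B) (\<lambda>_. 1) (\<lambda>_. \<eta>) x0 (Suc T))
      = (\<integral>\<^sup>+ xc. (\<integral>\<^sup>+ (y, c). ennreal (err y) \<partial>scsg_epoch V n f B 1 \<eta> (fst xc)) \<partial>?P)"
    by (simp add: case_prod_unfold)
  also have "\<dots> \<le> (\<integral>\<^sup>+ xc. ennreal (1 / (1 + s)) * (ennreal (err (fst xc)) + ennreal (s * \<delta>)) \<partial>?P)"
  proof (intro nn_integral_mono_AE, unfold AE_measure_pmf_iff, rule ballI)
    fix xc assume "xc \<in> set_pmf ?P"
    then have V: "fst xc \<in> V"
      by (rule in_V)
    have "ennreal ((err (fst xc) + s * \<delta>) / (1 + s))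
        = ennreal (1 / (1 + s)) * (ennreal (err (fst xc)) + ennreal (s * \<delta>))"
      using minimum [OF V] s \<delta> by (simp flip: ennreal_plus ennreal_mult)
    with epoch [OF V]
    show "(\<integral>\<^sup>+ (y, c). ennreal (err y) \<partial>scsg_epoch V n f B 1 \<eta> (fst xc))
        \<le> ennreal (1 / (1 + s)) * (ennreal (err (fst xc)) + ennreal (s * \<delta>))"
      by simp
  qed
  also have "\<dots> = ennreal (1 / (1 + s)) * ((\<integral>\<^sup>+ (x, c). ennreal (err x) \<partial>?P) + ennreal (s * \<delta>))"
    by (simp add: nn_integral_cmult nn_integral_add case_prod_unfold)
  also have "\<dots> \<le> ennreal (1 / (1 + s)) * (ennreal (\<delta> + err x0 / (1 + s) ^ T) + ennreal (s * \<delta>))"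
    by (intro mult_left_mono add_right_mono Suc.IH) simp
  also have "\<dots> = ennreal (1 / (1 + s) * (\<delta> + err x0 / (1 + s) ^ T + s * \<delta>))"
    using minimum [OF x0] s \<delta> by (simp flip: ennreal_plus ennreal_mult)
  also have "1 / (1 + s) * (\<delta> + err x0 / (1 + s) ^ T + s * \<delta>) = \<delta> + err x0 / (1 + s) ^ Suc T"
  proof -
    have ne: "1 + s \<noteq> 0"
      using s by simp
    have "1 / (1 + s) * (\<delta> + e + s * \<delta>) = \<delta> + e / (1 + s)" for e
    proof -
      have eq: "\<delta> + e + s * \<delta> = (1 + s) * \<delta> + e"
        by (simp add: distrib_right)
      show ?thesis
        unfolding eq by (simp only: add_divide_distrib times_divide_eq_left mult_1_left
            nonzero_mult_div_cancel_left [OF ne])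
    qed
    then show ?thesis
      by simp
  qed
  finally show ?case .
qed

end

section \<open>Complexity\<close>

lemma expected_epoch_cost:
  assumes "1 \<le> B"
  shows "(\<integral>\<^sup>+ (y, c). ennreal (real c) \<partial>scsg_epoch V n f B 1 \<eta> x) = ennreal (2 * real B)"
proof -
  define p where "p = 1 - real B / real (B + 1)"
  have p_eq: "p = 1 / (real B + 1)"
    by (simp add: p_def field_simps)
  have p: "0 < p" "p \<le> 1"
    by (simp_all add: p_eq)
  have "(\<integral>\<^sup>+ (y, c). ennreal (real c) \<partial>scsg_epoch V n f B 1 \<eta> x)
      = (\<integral>\<^sup>+ N. ennreal (real (B + N)) \<partial>geometric_pmf p)"
    by (simp add: scsg_epoch_def p_def measure_pmf.emeasure_space_1 del: of_nat_add)
  also have "\<dots> = ennreal (measure_pmf.expectation (geometric_pmf p) (\<lambda>N. real (B + N)))"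
    using integrable_real_geometric_pmf [of p] p by (intro nn_integral_eq_integral) auto
  also have "measure_pmf.expectation (geometric_pmf p) (\<lambda>N. real (B + N)) = real B + (1 - p) / p"
    using integrable_real_geometric_pmf [of p] expectation_geometric_pmf [of p] p by simp
  also have "\<dots> = 2 * real B"
    by (simp add: p_eq field_simps)
  finally show ?thesis .
qed

lemma expected_scsg_cost:
  assumes "1 \<le> B"
  shows "(\<integral>\<^sup>+ (x, c). ennreal (real c) \<partial>scsg V n f (\<lambda>_. B) (\<lambda>_. 1) (\<lambda>_. \<eta>) x0 T)
    = ennreal (2 * real B * real T)"
proof (induction T)
  case (Suc T)
  let ?P = "scsg V n f (\<lambda>_. B) (\<lambda>_. 1) (\<lambda>_. \<eta>) x0 T"
  let ?E = "\<lambda>x. scsg_epoch V n f B 1 \<eta> x"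
  have "(\<integral>\<^sup>+ (x, c). ennreal (real c) \<partial>scsg V n f (\<lambda>_. B) (\<lambda>_. 1) (\<lambda>_. \<eta>) x0 (Suc T))
      = (\<integral>\<^sup>+ xc. (\<integral>\<^sup>+ yc. ennreal (real (snd xc)) + ennreal (real (snd yc)) \<partial>?E (fst xc)) \<partial>?P)"
    by (simp add: case_prod_unfold)
  also have "\<dots> = (\<integral>\<^sup>+ xc. ennreal (real (snd xc)) + ennreal (2 * real B) \<partial>?P)"
    using expected_epoch_cost [OF assms, of V n f \<eta>, unfolded case_prod_unfold]
    by (simp add: nn_integral_add measure_pmf.emeasure_space_1 case_prod_unfold)
  also have "\<dots> = ennreal (2 * real B * real T) + ennreal (2 * real B)"
    using Suc by (simp add: nn_integral_add measure_pmf.emeasure_space_1 case_prod_unfold)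
  also have "\<dots> = ennreal (2 * real B * real (Suc T))"
    by (simp add: algebra_simps flip: ennreal_plus)
  finally show ?case .
qed simp

text \<open>
  This turns the contraction factor into a number of epochs: \<open>ln (1 + s) \<ge> s / (1 + s)\<close>, and doubling
  the exponent \<open>M\<close> buys the factor 2, since \<open>exp M \<ge> 2\<close>.
\<close>

lemma power_dominates_exp:
  fixes s M :: real
  assumes s: "0 < s" and T: "2 * M * (1 + 1 / s) \<le> real T" and M: "1 \<le> M"
  shows "2 * exp M \<le> (1 + s) ^ T"
proof -
  have "ln (inverse (1 + s)) \<le> inverse (1 + s) - 1"
    using s by (intro ln_le_minus_one) simp
  moreover have "ln (inverse (1 + s)) = - ln (1 + s)"
    by (rule ln_inverse)
  moreover have "s / (1 + s) = 1 - inverse (1 + s)"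
  proof -
    have "s / (1 + s) = (1 + s) / (1 + s) - 1 / (1 + s)"
      unfolding diff_divide_distrib [symmetric] by simp
    then show ?thesis
      using s by (simp add: inverse_eq_divide)
  qed
  ultimately have "s / (1 + s) \<le> ln (1 + s)"
    by linarith
  then have "2 * M * (1 + 1 / s) * (s / (1 + s)) \<le> real T * ln (1 + s)"
    using s M T by (intro mult_mono) auto
  moreover have "2 * M * (1 + 1 / s) * (s / (1 + s)) = 2 * M"
  proof -
    have "1 + 1 / s = (1 + s) / s"
      using s by (simp add: add_divide_distrib)
    then have "(1 + 1 / s) * (s / (1 + s)) = 1"
      using s by simp
    then show ?thesis
      by (simp only: mult.assoc mult_1_right)
  qed
  ultimately have "exp (2 * M) \<le> exp (real T * ln (1 + s))"
    by simp
  also have "\<dots> = (1 + s) ^ T"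
    using s by (simp add: exp_of_nat_mult)
  finally have "exp (2 * M) \<le> (1 + s) ^ T" .
  moreover have "2 * exp M \<le> exp M * exp M"
  proof (rule mult_right_mono)
    show "2 \<le> exp M"
      using exp_ge_add_one_self [of M] M by linarith
  qed simp
  moreover have "exp (2 * M) = exp M * exp M"
    unfolding mult_2 by (rule exp_add)
  ultimately show ?thesis
    by linarith
qed

context pl_finite_sum
begin

text \<open>
  The batch size falls short of \<open>12 H / (\<mu> \<epsilon>)\<close> only if it is \<open>n\<close>, and then the snapshot gradient is exact.
\<close>

lemma snapshot_error_le:
  fixes B :: nat
  assumes x: "x \<in> V" and H: "grad_variance V n f x \<le> H" and \<epsilon>: "0 < \<epsilon>" and B: "1 \<le> B" "B \<le> n"
    and ge: "min (12 * H / (\<mu> * \<epsilon>)) (real n) \<le> real B"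
  shows "measure_pmf.expectation (minibatch n B) (\<lambda>I. (norm (batch_grad V f I x - GF x))\<^sup>2)
    \<le> \<mu> * \<epsilon> / 12"
proof (cases "B = n")
  case True
  have "I = {1..n}" if "I \<in> set_pmf (minibatch n n)" for I
    using that minibatch_support(3) [of n n] card_subset_eq [of "{1..n}" I] by auto
  then have "AE I in minibatch n n. (norm (batch_grad V f I x - GF x))\<^sup>2 = 0"
    using batch_grad_full [OF x] by (auto simp: AE_measure_pmf_iff)
  then have "measure_pmf.expectation (minibatch n n) (\<lambda>I. (norm (batch_grad V f I x - GF x))\<^sup>2) = 0"
    by (rule integral_eq_zero_AE)
  then show ?thesis
    using True \<epsilon> \<mu>_pos by simp
next
  case False
  then have "12 * H / (\<mu> * \<epsilon>) \<le> real B"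
    using ge B(2) by (auto simp: min_def split: if_splits)
  then have "H / real B \<le> \<mu> * \<epsilon> / 12"
    using \<epsilon> \<mu>_pos B(1) by (simp add: field_simps)
  moreover have "grad_variance V n f x / real B \<le> H / real B"
    using H by (intro divide_right_mono) auto
  ultimately show ?thesis
    using batch_grad_variance [OF B x] by linarith
qed

text \<open>
  The error bound \<open>\<mu> \<epsilon> / 12\<close> of the snapshot gradient enters an epoch as \<open>B \<eta> / 2 \<cdot> \<mu> \<epsilon> / 12 = s \<cdot> \<epsilon> / 24\<close>,
  so the error bounds tend to \<open>\<epsilon> / 24\<close>, and it suffices to bring their excess down to \<open>\<epsilon> / 2\<close>. Rounding
  up costs little: \<open>B \<ge> 8\<close> forces \<open>B\<close> to be at most \<open>8 / 7\<close> times the unrounded value, and hence at most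
  \<open>14 m\<close>. The same assumption gives \<open>t \<ge> 2\<close>.
\<close>

lemma scsg_complexity:
  fixes B :: nat and \<epsilon> H \<eta> :: real
  assumes x0: "x0 \<in> V" and \<epsilon>: "0 < \<epsilon>" and H: "\<And>x. x \<in> V \<Longrightarrow> grad_variance V n f x \<le> H"
    and B: "B = nat \<lceil>min (12 * H / (\<mu> * \<epsilon>)) (real n)\<rceil>" and B8: "8 \<le> B"
    and \<eta>: "\<eta> = 1 / (6 * L * real B powr (2/3))"
  defines "run \<equiv> scsg V n f (\<lambda>_. B) (\<lambda>_. 1) (\<lambda>_. \<eta>) x0"
    and "m \<equiv> min (H / (\<mu> * \<epsilon>)) (real n)"
    and "M \<equiv> max (ln (err x0 / \<epsilon>)) 1"
  shows "\<exists>T. eps_accurate_from run err \<epsilon> T"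
    and "expected_C_comp run err \<epsilon> \<le> ennreal ((84 + 504 * L) * ((m + 1 / \<mu> * m powr (2/3)) * M))"
proof -
  define z where "z = min (12 * H / (\<mu> * \<epsilon>)) (real n)"
  have B_z: "B = nat \<lceil>z\<rceil>"
    unfolding z_def by (rule B)
  have z_le: "z \<le> real B" and B_less: "real B < z + 1"
    using B8 unfolding B_z by linarith+
  have "z \<le> real n"
    by (simp add: z_def)
  then have B_le_n: "B \<le> n"
    unfolding B_z by (simp add: nat_le_iff ceiling_le_iff)
  have "0 < z"
    using B8 B_less by linarith
  then have H_pos: "0 < 12 * H / (\<mu> * \<epsilon>)"
    by (simp add: z_def)
  then have "12 * min (H / (\<mu> * \<epsilon>)) (real n) \<ge> z"
    by (auto simp: z_def min_def)
  then have B_m: "real B \<le> 14 * m"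
    using B8 B_less by (simp add: m_def)
  have m_pos: "0 < m"
    using B_m B8 by linarith
  define t where "t = real B powr (1/3)"
  have B_t: "real B = t ^ 3" and t2: "real B powr (2/3) = t\<^sup>2" and t_pos: "0 < t"
    using B8 by (simp_all add: t_def powr_powr flip: powr_realpow)
  have t: "2 \<le> t"
  proof (rule ccontr)
    assume "\<not> 2 \<le> t"
    then have "t ^ 3 < 2 ^ 3"
      using t_pos by (intro power_strict_mono) auto
    then show False
      using B8 B_t by simp
  qed
  have \<eta>_t: "\<eta> = 1 / (6 * L * t\<^sup>2)"
    by (simp add: \<eta> t2)
  then have \<eta>_pos: "0 < \<eta>"
    using L_pos t by simp
  define s where "s = real B * \<eta> * \<mu>"
  have s_pos: "0 < s"
    using \<eta>_pos \<mu>_pos B8 by (simp add: s_def)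
  have err0: "0 \<le> err x0"
    using minimum [OF x0] by simp
  have M1: "1 \<le> M"
    by (simp add: M_def)
  have epoch: "(\<integral>\<^sup>+ (y, c). ennreal (err y) \<partial>scsg_epoch V n f B 1 \<eta> x)
      \<le> ennreal ((err x + s * (\<epsilon> / 24)) / (1 + s))" if x: "x \<in> V" for x
  proof -
    have "measure_pmf.expectation (minibatch n B) (\<lambda>I. (norm (batch_grad V f I x - GF x))\<^sup>2)
        \<le> \<mu> * \<epsilon> / 12"
      using snapshot_error_le [OF x H [OF x] \<epsilon> _ B_le_n] z_le B8 by (simp add: z_def)
    from epoch_contraction [OF x t B_t B_le_n \<eta>_t this] show ?thesis
      by (simp add: s_def mult_ac)
  qed
  define T where "T = nat \<lceil>2 * M * (1 + 1 / s)\<rceil>"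
  have T_ge: "2 * M * (1 + 1 / s) \<le> real T"
    unfolding T_def by linarith
  have accurate: "eps_accurate_from run err \<epsilon> T"
    unfolding eps_accurate_from_def
  proof (intro allI impI)
    fix T' assume "T \<le> T'"
    then have T': "2 * M * (1 + 1 / s) \<le> real T'"
      using T_ge by linarith
    have "err x0 / \<epsilon> \<le> exp M"
    \<comment> \<open>For \<open>err x0 = 0\<close> the logarithm in \<open>M\<close> takes the default value \<open>ln 0 = 0\<close>.\<close>
    proof (cases "err x0 = 0")
      case False
      then have "err x0 / \<epsilon> = exp (ln (err x0 / \<epsilon>))"
        using err0 \<epsilon> by simp
      also have "\<dots> \<le> exp M"
        by (simp add: M_def)
      finally show ?thesis .
    qed simp
    then have "2 * (err x0 / \<epsilon>) \<le> (1 + s) ^ T'"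
      using power_dominates_exp [OF s_pos T' M1] by linarith
    then have "err x0 / (1 + s) ^ T' \<le> \<epsilon> / 2"
      using \<epsilon> s_pos by (simp add: field_simps)
    then have "\<epsilon> / 24 + err x0 / (1 + s) ^ T' \<le> \<epsilon>"
      using \<epsilon> by linarith
    moreover have "(\<integral>\<^sup>+ (x, c). ennreal (err x) \<partial>run T') \<le> ennreal (\<epsilon> / 24 + err x0 / (1 + s) ^ T')"
      unfolding run_def using s_pos \<epsilon> by (intro scsg_error x0 B_le_n epoch) auto
    ultimately show "(\<integral>\<^sup>+ (x, c). ennreal (err x) \<partial>run T') \<le> ennreal \<epsilon>"
      by (meson ennreal_leI order_trans)
  qed
  then show "\<exists>T. eps_accurate_from run err \<epsilon> T" ..
  have cost: "(\<integral>\<^sup>+ (x, c). ennreal (real c) \<partial>run T) = ennreal (2 * real B * real T)" for T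
    unfolding run_def using B8 by (intro expected_scsg_cost) simp
  define q where "q = 1 / \<mu> * m powr (2/3)"
  have "T_eps run err \<epsilon> \<le> T"
    unfolding T_eps_def using accurate by (rule Least_le)
  then have "2 * real B * real (T_eps run err \<epsilon>) \<le> 2 * real B * real T"
    by (intro mult_left_mono) auto
  also have "\<dots> \<le> 2 * real B * (3 * M * (1 + 1 / s))"
  proof (intro mult_left_mono)
    have "1 * 1 \<le> M * (1 + 1 / s)"
      using M1 s_pos by (intro mult_mono) auto
    moreover have "0 \<le> 2 * M * (1 + 1 / s)"
      using M1 s_pos by simp
    then have "real T \<le> 2 * M * (1 + 1 / s) + 1"
      unfolding T_def by linarith
    ultimately show "real T \<le> 3 * M * (1 + 1 / s)"
      unfolding mult.assoc by linarith
  qed simp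
  also have "\<dots> = 6 * M * (real B + 6 * L / \<mu> * real B powr (2/3))"
  proof -
    have "real B * (1 / s) = 1 / (\<eta> * \<mu>)"
      using B8 by (simp add: s_def)
    also have "\<dots> = 6 * L / \<mu> * real B powr (2/3)"
      by (simp add: \<eta>)
    finally have "real B * (1 + 1 / s) = real B + 6 * L / \<mu> * real B powr (2/3)"
      by (simp only: distrib_left mult_1_right)
    moreover have "2 * real B * (3 * M * (1 + 1 / s)) = 6 * M * (real B * (1 + 1 / s))"
      by simp
    ultimately show ?thesis
      by (simp only:)
  qed
  also have "\<dots> \<le> 6 * M * (14 * m + 6 * L / \<mu> * (14 * m powr (2/3)))"
  proof (intro mult_left_mono add_mono)
    have "real B powr (2/3) \<le> (14 * m) powr (2/3)"
      using B_m by (intro powr_mono2) auto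
    also have "\<dots> = 14 powr (2/3) * m powr (2/3)"
      using m_pos by (simp add: powr_mult)
    also have "\<dots> \<le> 14 powr 1 * m powr (2/3)"
      by (intro mult_right_mono powr_mono) auto
    finally show "real B powr (2/3) \<le> 14 * m powr (2/3)"
      by simp
  qed (use B_m M1 L_pos \<mu>_pos in auto)
  also have "\<dots> = 84 * (M * m) + 504 * L * (M * q)"
    by (simp add: q_def distrib_left)
  also have "\<dots> \<le> (84 + 504 * L) * (M * m) + (84 + 504 * L) * (M * q)"
    using M1 L_pos \<mu>_pos m_pos by (intro add_mono mult_right_mono) (auto simp: q_def)
  also have "\<dots> = (84 + 504 * L) * ((m + q) * M)"
    by (simp only: distrib_left distrib_right mult_ac)
  finally show "expected_C_comp run err \<epsilon>
      \<le> ennreal ((84 + 504 * L) * ((m + 1 / \<mu> * m powr (2/3)) * M))"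
    unfolding expected_C_comp_def cost q_def by (rule ennreal_leI)
qed

end

theorem corollary3p6:
  fixes L :: real
  assumes "0 < L"
  shows "\<exists>C::real. \<forall>(d::nat) (n::nat) (f :: nat \<Rightarrow> (nat \<Rightarrow>\<^sub>0 real) \<Rightarrow> real)
      (xs :: nat \<Rightarrow>\<^sub>0 real) (x0 :: nat \<Rightarrow>\<^sub>0 real) (\<mu>::real) (\<epsilon>::real).
    let V = Rn d;
        F = avg_fun n f;
        H = (SUP x\<in>V. grad_variance V n f x);
        B = nat \<lceil>min (12 * H / (\<mu> * \<epsilon>)) (real n)\<rceil>;
        \<eta> = 1 / (6 * L * real B powr (2/3));
        run = scsg V n f (\<lambda>j. B) (\<lambda>j. 1) (\<lambda>j. \<eta>) x0;
        err = (\<lambda>x. F x - F xs);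
        \<Delta> = F x0 - F xs;
        m = min (H / (\<mu> * \<epsilon>)) (real n)
    in 1 \<le> d \<longrightarrow> 1 \<le> n \<longrightarrow> x0 \<in> V
      \<longrightarrow> (\<forall>i\<in>{1..n}. f i differentiable_on V)
      \<longrightarrow> (\<forall>i\<in>{1..n}. \<forall>x\<in>V. \<forall>y\<in>V. norm (grad V (f i) x - grad V (f i) y) \<le> L * norm (x - y))
      \<longrightarrow> bdd_above (grad_variance V n f ` V)
      \<longrightarrow> xs \<in> V \<longrightarrow> (\<forall>x\<in>V. F xs \<le> F x)
      \<longrightarrow> 0 < \<mu> \<longrightarrow> (\<forall>x\<in>V. (norm (grad V F x))\<^sup>2 \<ge> 2 * \<mu> * (F x - F xs))
      \<longrightarrow> 0 < \<epsilon>
      \<longrightarrow> 8 \<le> B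
      \<longrightarrow> (\<exists>T. eps_accurate_from run err \<epsilon> T)
        \<and> expected_C_comp run err \<epsilon>
            \<le> ennreal (C * ((m + 1 / \<mu> * m powr (2/3)) * max (ln (\<Delta> / \<epsilon>)) 1))"
proof (intro exI [of _ "84 + 504 * L"] allI, unfold Let_def, intro impI)
  fix d n :: nat and f :: "nat \<Rightarrow> (nat \<Rightarrow>\<^sub>0 real) \<Rightarrow> real" and xs x0 :: "nat \<Rightarrow>\<^sub>0 real" and \<mu> \<epsilon> :: real
  let ?V = "Rn d"
  let ?F = "avg_fun n f"
  let ?H = "SUP x\<in>?V. grad_variance ?V n f x"
  let ?B = "nat \<lceil>min (12 * ?H / (\<mu> * \<epsilon>)) (real n)\<rceil>"
  let ?run = "scsg ?V n f (\<lambda>j. ?B) (\<lambda>j. 1) (\<lambda>j. 1 / (6 * L * real ?B powr (2/3))) x0"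
  let ?m = "min (?H / (\<mu> * \<epsilon>)) (real n)"
  assume n: "1 \<le> n" and x0: "x0 \<in> ?V"
    and diff: "\<forall>i\<in>{1..n}. f i differentiable_on ?V"
    and lip: "\<forall>i\<in>{1..n}. \<forall>x\<in>?V. \<forall>y\<in>?V.
      norm (grad ?V (f i) x - grad ?V (f i) y) \<le> L * norm (x - y)"
    and bdd: "bdd_above (grad_variance ?V n f ` ?V)"
    and min: "\<forall>x\<in>?V. ?F xs \<le> ?F x"
    and \<mu>: "0 < \<mu>" and PL: "\<forall>x\<in>?V. 2 * \<mu> * (?F x - ?F xs) \<le> (norm (grad ?V ?F x))\<^sup>2"
    and \<epsilon>: "0 < \<epsilon>" and B8: "8 \<le> ?B"
  interpret pl_finite_sum d n f L xs \<mu>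
    by unfold_locales (use n \<open>0 < L\<close> diff lip min \<mu> PL in auto)
  have H: "grad_variance ?V n f x \<le> ?H" if "x \<in> ?V" for x
    using bdd that by (rule cSUP_upper2) simp
  show "(\<exists>T. eps_accurate_from ?run (\<lambda>x. ?F x - ?F xs) \<epsilon> T)
      \<and> expected_C_comp ?run (\<lambda>x. ?F x - ?F xs) \<epsilon>
        \<le> ennreal ((84 + 504 * L) * ((?m + 1 / \<mu> * ?m powr (2/3)) * max (ln ((?F x0 - ?F xs) / \<epsilon>)) 1))"
    using scsg_complexity [OF x0 \<epsilon> H refl B8 refl] by blast
qed

end
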